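(* Let $y \in \mathcal{I}(S_n)$ be an involution and let $z\in\mathcal I(S_{2n})$ be a fixed-point-free involution. If $y$ and $z$ are dominant, then $$\hat{\mathfrak S}_y = 2^{-\kappa(y)}\prod_{(i,j)\in\hat D(y)}(x_i+x_j)\qquad\text{and}\qquad \hat{\mathfrak S}^{\mathrm{FPF}}_z=\prod_{(i,j)\in\hat D_{\mathrm{FPF}}(z)}(x_i+x_j).$$
   Context: Let $s_i=(i,i+1)$ and $\mathbb P=\{1,2,\dots\}$. $\mathcal I(S_n)=\{w\in S_n: w=w^{-1}\}$ (the identity is included), and $\kappa(y)$ is the number of 2-cycles of $y$. A permutation is dominant if it is 132-avoiding. For an involution $y$, $$\hat D(y)=\{(i,j)\in\mathbb P\times\mathbb P: j<y(i),\ i<y(j),\ j\le i\},\qquad \hat D_{\mathrm{FPF}}(y)=\{(i,j)\in\mathbb P\times\mathbb P: j<y(i),\ i<y(j),\ j<i\},$$ where $y$ is extended to $\mathbb P$ by fixing all larger integers. For an involution $y$ and an index $i$, set $y\rtimes s_i = ys_i$ if $ys_i=s_iy$ and $y\rtimes s_i=s_iys_i$ otherwise. An involution word for an involution $z$ is a sequence of positive integers $(a_1,\dots,a_k)$ of shortest possible length such that $z=(\cdots((1\rtimes s_{a_1})\rtimes s_{a_2})\rtimes\cdots)\rtimes s_{a_k}$; $\hat{\mathcal R}(z)$ is the set of these. For involutions $y,z$, $\hat{\mathcal R}(y,z)$ is the set of sequences which, when appended to involution words of $y$, produce involution words of $z$ (this does not depend on the chosen involution word of $y$). For a sequence $a=(a_1,\dots,a_k)$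 of positive integers, $C(a)$ is the set of sequences of positive integers $I=(i_1\le i_2\le\dots\le i_k)$ with $i_j<i_{j+1}$ whenever $a_j<a_{j+1}$; $I\le a$ means $i_j\le a_j$ for all $j$; $x_I=x_{i_1}\cdots x_{i_k}$. The involution Schubert polynomials are $$\hat{\mathfrak S}_{y,z}=\sum_{a\in\hat{\mathcal R}(y,z)}\ \sum_{I\in C(a),\, I\le a}x_I,\qquad \hat{\mathfrak S}_y=\hat{\mathfrak S}_{1,y},\qquad \hat{\mathfrak S}^{\mathrm{FPF}}_z=\hat{\mathfrak S}_{v_n,z},$$ where $v_n=(1,2)(3,4)\cdots(2n-1,2n)\in S_{2n}$. *)

theory Defs
  imports Complex_Main "HOL-Combinatorics.Permutations" "HOL-Library.Poly_Mapping"
begin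

text \<open>
  Permutations of the positive integers with finite support are functions
  \<^typ>\<open>nat \<Rightarrow> nat\<close> fixing \<open>0\<close>; \<open>S\<^sub>n\<close> is the set of all \<open>w\<close> with \<open>w permutes {1..n}\<close>,
  so elements of \<open>S\<^sub>n\<close> already come extended by fixing all larger integers.
\<close>

definition involutions :: "nat \<Rightarrow> (nat \<Rightarrow> nat) set" where
  "involutions n = {w. w permutes {1..n} \<and> w = inv w}"

definition fpf_involutions :: "nat \<Rightarrow> (nat \<Rightarrow> nat) set" where
  "fpf_involutions n = {w \<in> involutions n. \<forall>i\<in>{1..n}. w i \<noteq> i}"

definition simple_refl :: "nat \<Rightarrow> nat \<Rightarrow> nat" where
  "simple_refl i = transpose i (i + 1)"

definition num_two_cycles :: "(nat \<Rightarrow> nat) \<Rightarrow> nat" where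
  "num_two_cycles y = card {(i, j). i < j \<and> y i = j \<and> y j = i}"

text \<open>
  132-avoidance. The positions range over all positive integers; for \<open>w \<in> S\<^sub>n\<close> this is the
  same as avoidance in the word \<open>w(1) \<dots> w(n)\<close>, see \<open>dominant_iff\<close>.
  Position \<open>0\<close> has to be excluded.
\<close>

definition dominant :: "(nat \<Rightarrow> nat) \<Rightarrow> bool" where
  "dominant w \<longleftrightarrow> \<not> (\<exists>i j k. 1 \<le> i \<and> i < j \<and> j < k \<and> w i < w k \<and> w k < w j)"

lemma dominant_iff:
  assumes "w permutes {1..n}"
  shows "dominant w \<longleftrightarrow>
    \<not> (\<exists>i j k. 1 \<le> i \<and> i < j \<and> j < k \<and> k \<le> n \<and> w i < w k \<and> w k < w j)"
proof -
  have "k \<le> n" if "1 \<le> i" "i < j" "j < k" "w k < w j" for i j k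
  proof (rule ccontr)
    assume "\<not> k \<le> n"
    then have "w k = k" using assms by (simp add: permutes_not_in)
    with that \<open>\<not> k \<le> n\<close> have "w j \<notin> {1..n}" by simp
    then have "j \<notin> {1..n}" using permutes_in_image[OF assms, of j] by blast
    then have "w j = j" using assms by (rule permutes_not_in[rotated])
    with \<open>w k = k\<close> that show False by simp
  qed
  then show ?thesis unfolding dominant_def by blast
qed

definition inv_diagram :: "(nat \<Rightarrow> nat) \<Rightarrow> (nat \<times> nat) set" where
  "inv_diagram y = {(i, j). 1 \<le> i \<and> 1 \<le> j \<and> j < y i \<and> i < y j \<and> j \<le> i}"

definition fpf_diagram :: "(nat \<Rightarrow> nat) \<Rightarrow> (nat \<times> nat) set" where
  "fpf_diagram y = {(i, j). 1 \<le> i \<and> 1 \<le> j \<and> j < y i \<and> i < y j \<and> j < i}"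

text \<open>\<open>y \<rtimes> s\<^sub>i\<close>; not the Demazure action, a step may shorten \<open>y\<close>.\<close>

definition inv_step :: "(nat \<Rightarrow> nat) \<Rightarrow> nat \<Rightarrow> (nat \<Rightarrow> nat)" where
  "inv_step y i =
    (if y \<circ> simple_refl i = simple_refl i \<circ> y then y \<circ> simple_refl i
     else simple_refl i \<circ> y \<circ> simple_refl i)"

definition inv_act :: "(nat \<Rightarrow> nat) \<Rightarrow> nat list \<Rightarrow> (nat \<Rightarrow> nat)" where
  "inv_act y a = foldl inv_step y a"

definition pos_words :: "nat list set" where
  "pos_words = {a. \<forall>i\<in>set a. 1 \<le> i}"

definition inv_words :: "(nat \<Rightarrow> nat) \<Rightarrow> nat list set" where
  "inv_words z = {a \<in> pos_words. inv_act id a = z \<and>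
     (\<forall>b\<in>pos_words. inv_act id b = z \<longrightarrow> length a \<le> length b)}"

text \<open>
  The set \<open>R(y,z)\<close> of words which, appended to an involution word of \<open>y\<close>, produce an involution
  word of \<open>z\<close>. The choice of the involution word of \<open>y\<close> is irrelevant, see \<open>rel_inv_words_indep\<close>.
\<close>

definition rel_inv_words :: "(nat \<Rightarrow> nat) \<Rightarrow> (nat \<Rightarrow> nat) \<Rightarrow> nat list set" where
  "rel_inv_words y z = {c. \<exists>a\<in>inv_words y. a @ c \<in> inv_words z}"

lemma rel_inv_words_indep:
  assumes "a \<in> inv_words y"
  shows "c \<in> rel_inv_words y z \<longleftrightarrow> a @ c \<in> inv_words z"
proof -
  have "b @ c \<in> inv_words z"
    if "a @ c \<in> inv_words z" "a \<in> inv_words y" "b \<in> inv_words y" for a b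
  proof -
    have "length a = length b"
      using that(2,3) by (auto simp: inv_words_def intro: antisym)
    then show ?thesis
      using that by (auto simp: inv_words_def inv_act_def pos_words_def)
  qed
  with assms show ?thesis unfolding rel_inv_words_def by blast
qed

text \<open>
  Polynomials over \<open>\<rat>\<close> in variables indexed by \<^typ>\<open>nat\<close> (the variable with index \<open>0\<close> is never
  used): finitely supported maps from exponent vectors to coefficients, with the convolution product.
\<close>

type_synonym rat_mpoly = "(nat \<Rightarrow>\<^sub>0 nat) \<Rightarrow>\<^sub>0 rat"

definition var :: "nat \<Rightarrow> rat_mpoly" where
  "var i = Poly_Mapping.single (Poly_Mapping.single i 1) 1"

definition const :: "rat \<Rightarrow> rat_mpoly" where
  "const c = Poly_Mapping.single 0 c"

definition compatible_seqs :: "nat list \<Rightarrow> nat list set" where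
  "compatible_seqs a = {I \<in> pos_words. length I = length a \<and>
     (\<forall>j. j + 1 < length a \<longrightarrow>
        I ! j \<le> I ! (j + 1) \<and> (a ! j < a ! (j + 1) \<longrightarrow> I ! j < I ! (j + 1)))}"

definition seq_le :: "nat list \<Rightarrow> nat list \<Rightarrow> bool" where
  "seq_le I a \<longleftrightarrow> list_all2 (\<le>) I a"

definition monomial :: "nat list \<Rightarrow> rat_mpoly" where
  "monomial I = (\<Prod>i\<leftarrow>I. var i)"

definition rel_inv_schubert :: "(nat \<Rightarrow> nat) \<Rightarrow> (nat \<Rightarrow> nat) \<Rightarrow> rat_mpoly" where
  "rel_inv_schubert y z =
    (\<Sum>a\<in>rel_inv_words y z. \<Sum>I\<in>{I \<in> compatible_seqs a. seq_le I a}. monomial I)"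

definition inv_schubert :: "(nat \<Rightarrow> nat) \<Rightarrow> rat_mpoly" where
  "inv_schubert y = rel_inv_schubert id y"

definition min_fpf :: "nat \<Rightarrow> nat \<Rightarrow> nat" where
  "min_fpf n i = (if i \<in> {1..2 * n} then (if odd i then i + 1 else i - 1) else i)"

definition fpf_schubert :: "nat \<Rightarrow> (nat \<Rightarrow> nat) \<Rightarrow> rat_mpoly" where
  "fpf_schubert n z = rel_inv_schubert (min_fpf n) z"

end

theory Submission
  imports Defs
begin

text \<open>
  On functions of involutions let \<open>F u\<^sub>i\<close> take the value \<open>F (z \<rtimes> s\<^sub>i)\<close> at an involution \<open>z\<close> with a descent
  at \<open>i\<close>, and \<open>0\<close> at the others. The \<open>u\<^sub>i\<close> satisfy the nilCoxeter relations, so \<open>h\<^sub>i(x) = 1 + x u\<^sub>i\<close> satisfies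
  the Yang--Baxter equation. With \<open>A\<^sub>k(x) = h\<^sub>N\<^sub>-\<^sub>1(x) \<cdots> h\<^sub>k(x)\<close> and \<open>B\<^sub>k(x) = h\<^sub>k(x) \<cdots> h\<^sub>N\<^sub>-\<^sub>1(x)\<close> the
  polynomial attached to \<open>(v, z)\<close> is the value at \<open>z\<close> of \<open>\<delta>\<^sub>v A\<^sub>1(x\<^sub>1) A\<^sub>2(x\<^sub>2) \<cdots>\<close>.

  The Yang--Baxter equation gives \<open>B\<^sub>k(x) A\<^sub>k(y) = A\<^sub>k\<^sub>+\<^sub>1(y) h\<^sub>k(x+y) B\<^sub>k\<^sub>+\<^sub>1(x)\<close>, and the starting vectors
  satisfy \<open>\<delta> A\<^sub>k(x) = \<delta> B\<^sub>k(x)\<close> (identity), respectively \<open>\<delta> A\<^sub>k(x) = \<delta> B\<^sub>k\<^sub>+\<^sub>1(x)\<close> for odd \<open>k\<close> (the minimal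
  fixed-point-free involution). Hence \<open>\<delta> A\<^sub>1(x\<^sub>1) A\<^sub>2(x\<^sub>2) \<cdots>\<close> equals
  \<open>\<delta> A\<^sub>3(x\<^sub>2) A\<^sub>4(x\<^sub>3) \<cdots>\<close> times the row \<open>h\<^sub>1(x\<^sub>1) h\<^sub>2(x\<^sub>1+x\<^sub>2) h\<^sub>3(x\<^sub>1+x\<^sub>3) \<cdots>\<close>, where the factor \<open>h\<^sub>1(x\<^sub>1)\<close> is
  absent in the fixed-point-free case. If \<open>z\<close> is dominant with \<open>z(1) = k + 1\<close>, then \<open>z\<close> has no descent
  beyond \<open>k\<close>, and only the choice of the letters up to \<open>k\<close> in this row contributes. The weights of these
  letters are the factors of the first column of the diagram, and what remains is the involution obtained
  from \<open>z\<close> by deleting the cycle \<open>(1, k+1)\<close>, which is again dominant.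
\<close>

section \<open>Steps between involutions\<close>

definition involution :: "(nat \<Rightarrow> nat) \<Rightarrow> bool" where
  "involution z \<longleftrightarrow> (\<forall>p. z (z p) = p)"

lemma involutionD: "involution z \<Longrightarrow> z (z p) = p"
  by (simp add: involution_def)

lemma involution_eq_iff: "involution z \<Longrightarrow> z p = z q \<longleftrightarrow> p = q"
  by (metis involution_def)

lemma simple_refl_apply:
  "simple_refl i p = (if p = i then Suc i else if p = Suc i then i else p)"
  by (auto simp: simple_refl_def transpose_def)

lemma simple_refl_simple_refl [simp]: "simple_refl i (simple_refl i p) = p"
  by (simp add: simple_refl_apply)

lemma simple_refl_less_iff:
  assumes "a \<noteq> b" "\<not> (a = i \<and> b = Suc i)" "\<not> (a = Suc i \<and> b = i)"
  shows "simple_refl i a < simple_refl i b \<longleftrightarrow> a < b"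
  using assms by (auto simp: simple_refl_apply)

lemma involution_id: "involution id"
  and involution_simple_refl: "involution (simple_refl i)"
  by (simp_all add: involution_def)

text \<open>Commuting with \<open>simple_refl i\<close> amounts to preserving the set {i, i+1}; an
  involution that does so exchanges the two points or fixes both.\<close>

lemma commutes_simple_refl_iff:
  assumes "involution z"
  shows "z \<circ> simple_refl i = simple_refl i \<circ> z \<longleftrightarrow>
    z i = Suc i \<or> (z i = i \<and> z (Suc i) = Suc i)" (is "?L \<longleftrightarrow> ?R")
proof
  assume ?L
  then have "z (simple_refl i i) = simple_refl i (z i)" by (metis comp_apply)
  then have "z (Suc i) = simple_refl i (z i)" by (simp add: simple_refl_apply)
  then show ?R using involution_eq_iff[OF assms, of i "Suc i"]
    by (auto simp: simple_refl_apply split: if_splits)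
next
  assume ?R
  then have R: "z i = Suc i \<and> z (Suc i) = i \<or> z i = i \<and> z (Suc i) = Suc i"
    using involutionD[OF assms, of i] by auto
  have "z p \<noteq> i" "z p \<noteq> Suc i" if "p \<noteq> i" "p \<noteq> Suc i" for p
    using that R involutionD[OF assms, of p] by metis+
  then have "z (simple_refl i p) = simple_refl i (z p)" for p
    using R unfolding simple_refl_apply by (cases "p = i \<or> p = Suc i") auto
  then show ?L by (simp add: fun_eq_iff)
qed

lemma inv_step_apply:
  assumes "involution z"
  shows "inv_step z i p = (if z i = Suc i \<or> (z i = i \<and> z (Suc i) = Suc i)
    then z (simple_refl i p) else simple_refl i (z (simple_refl i p)))"
  using commutes_simple_refl_iff[OF assms, of i] by (simp add: inv_step_def)

lemma simple_refl_comp_eq: 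
  "simple_refl i \<circ> simple_refl i = id"
  "simple_refl i \<circ> (simple_refl i \<circ> f) = f"
  "g \<circ> simple_refl i \<circ> simple_refl i = g"
  by (simp_all add: fun_eq_iff)

lemma inv_step_commuting:
  "z \<circ> simple_refl i = simple_refl i \<circ> z \<Longrightarrow> inv_step z i = z \<circ> simple_refl i"
  unfolding inv_step_def by (rule if_P)

lemma involution_inv_step:
  assumes "involution z"
  shows "involution (inv_step z i)"
proof (cases "z \<circ> simple_refl i = simple_refl i \<circ> z")
  case True
  then have "z (simple_refl i p) = simple_refl i (z p)" for p by (metis comp_apply)
  moreover have "inv_step z i = z \<circ> simple_refl i"
    using True by (rule inv_step_commuting)
  ultimately show ?thesis
    unfolding involution_def by (simp add: involutionD[OF assms])
next
  case False
  then show ?thesis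
    by (simp add: involution_def inv_step_def involutionD[OF assms])
qed

text \<open>A step does not change whether the involution commutes with
  \<open>simple_refl i\<close>, so the second step takes the same branch and cancels the
  first.\<close>

lemma inv_step_inv_step:
  assumes "involution z"
  shows "inv_step (inv_step z i) i = z"
proof (cases "z \<circ> simple_refl i = simple_refl i \<circ> z")
  case True
  then have *: "inv_step z i = z \<circ> simple_refl i" by (rule inv_step_commuting)
  then have "inv_step z i \<circ> simple_refl i = simple_refl i \<circ> inv_step z i"
    using True by (metis comp_assoc)
  then have "inv_step (inv_step z i) i = inv_step z i \<circ> simple_refl i"
    by (rule inv_step_commuting)
  then show ?thesis by (simp add: * fun_eq_iff)
next
  case False
  let ?w = "simple_refl i \<circ> z \<circ> simple_refl i"
  have "?w \<circ> simple_refl i \<noteq> simple_refl i \<circ> ?w"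
    using False by (metis comp_assoc simple_refl_comp_eq(2,3))
  then show ?thesis using False
    by (simp add: inv_step_def) (metis comp_assoc simple_refl_comp_eq(2,3))
qed

lemma involution_sym: "involution z \<Longrightarrow> z p = q \<longleftrightarrow> z q = p"
  by (metis involution_def)

text \<open>Right multiplication by \<open>simple_refl i\<close> exchanges the two values. The left
  factor of a conjugation keeps their order, because the two values form the pair \<open>i\<close>,
  \<open>i + 1\<close> only in the commuting branch.\<close>

lemma inv_step_ascent_iff:
  assumes "involution z"
  shows "inv_step z i i < inv_step z i (Suc i) \<longleftrightarrow> z (Suc i) < z i"
proof -
  have "z i \<noteq> z (Suc i)" "z i = Suc i \<longleftrightarrow> z (Suc i) = i"
    using involution_eq_iff[OF assms, of i "Suc i"] involution_sym[OF assms, of i "Suc i"] by simp_all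
  moreover have "inv_step z i i = (if z i = Suc i \<or> z i = i \<and> z (Suc i) = Suc i
      then z (Suc i) else simple_refl i (z (Suc i)))"
    "inv_step z i (Suc i) = (if z i = Suc i \<or> z i = i \<and> z (Suc i) = Suc i
      then z i else simple_refl i (z i))"
    unfolding inv_step_apply[OF assms] by (simp_all add: simple_refl_apply)
  ultimately show ?thesis
    using simple_refl_less_iff[of "z (Suc i)" "z i" i] by auto
qed

lemma inv_step_descent_iff:
  assumes "involution z"
  shows "inv_step z i (Suc i) < inv_step z i i \<longleftrightarrow> z i < z (Suc i)"
  using inv_step_ascent_iff[OF involution_inv_step[OF assms], of i i]
  by (simp add: inv_step_inv_step[OF assms])

text \<open>A step at \<open>i\<close> does not affect whether the function commutes with
  \<open>simple_refl j\<close>, hence both orders multiply by the same reflections on the same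
  sides.\<close>

lemma inv_step_commute:
  assumes "Suc i < j"
  shows "inv_step (inv_step z i) j = inv_step (inv_step z j) i"
proof -
  have c: "simple_refl i (simple_refl j p) = simple_refl j (simple_refl i p)" for p
    using assms by (auto simp: simple_refl_apply)
  have *: "inv_step z i \<circ> simple_refl j = simple_refl j \<circ> inv_step z i \<longleftrightarrow>
      z \<circ> simple_refl j = simple_refl j \<circ> z"
    if c: "\<And>p. simple_refl i (simple_refl j p) = simple_refl j (simple_refl i p)" for i j
  proof
    assume "inv_step z i \<circ> simple_refl j = simple_refl j \<circ> inv_step z i"
    then have "inv_step z i (simple_refl j p) = simple_refl j (inv_step z i p)" for p
      by (metis comp_apply)
    note comm = this
    have "z (simple_refl i (simple_refl j p)) = simple_refl j (z (simple_refl i p))" for p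
    proof (cases "z \<circ> simple_refl i = simple_refl i \<circ> z")
      case True
      then have "inv_step z i = z \<circ> simple_refl i" by (rule inv_step_commuting)
      with comm[of p] show ?thesis by (simp only: comp_apply)
    next
      case False
      then have "simple_refl i (z (simple_refl i (simple_refl j p))) =
          simple_refl j (simple_refl i (z (simple_refl i p)))"
        using comm[of p] by (simp add: inv_step_def)
      from arg_cong[of _ _ "simple_refl i", OF this] show ?thesis by (simp add: c)
    qed
    then have "z (simple_refl j (simple_refl i (simple_refl i p))) =
        simple_refl j (z (simple_refl i (simple_refl i p)))" for p
      by (simp only: c)
    then show "z \<circ> simple_refl j = simple_refl j \<circ> z"
      by (simp add: fun_eq_iff)
  next
    assume "z \<circ> simple_refl j = simple_refl j \<circ> z"
    then have "z (simple_refl j p) = simple_refl j (z p)" for p by (metis comp_apply)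
    then show "inv_step z i \<circ> simple_refl j = simple_refl j \<circ> inv_step z i"
      by (simp add: inv_step_def fun_eq_iff c)
  qed
  have pq: "(if q then (if p then z \<circ> simple_refl i else simple_refl i \<circ> z \<circ> simple_refl i) \<circ> simple_refl j
      else simple_refl j \<circ> (if p then z \<circ> simple_refl i else simple_refl i \<circ> z \<circ> simple_refl i) \<circ> simple_refl j) =
    (if p then (if q then z \<circ> simple_refl j else simple_refl j \<circ> z \<circ> simple_refl j) \<circ> simple_refl i
      else simple_refl i \<circ> (if q then z \<circ> simple_refl j else simple_refl j \<circ> z \<circ> simple_refl j) \<circ> simple_refl i)"
    for p q
    by (cases p; cases q) (simp_all add: fun_eq_iff c)
  have **: "inv_step (inv_step z i) j = (if z \<circ> simple_refl j = simple_refl j \<circ> z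
      then inv_step z i \<circ> simple_refl j else simple_refl j \<circ> inv_step z i \<circ> simple_refl j)"
    if "\<And>p. simple_refl i (simple_refl j p) = simple_refl j (simple_refl i p)" for i j
    unfolding *[OF that, symmetric] by (rule inv_step_def)
  show ?thesis
    unfolding **[OF c] **[OF c[symmetric]] unfolding inv_step_def[of z] by (rule pq)
qed

lemma inv_step_apply_far:
  assumes "involution z" "p \<noteq> i" "p \<noteq> Suc i"
  shows "inv_step z i p = simple_refl i (z p)"
  using assms involution_sym[OF assms(1), of i "z p"] involution_sym[OF assms(1), of p i]
    involution_sym[OF assms(1), of p "Suc i"]
  by (auto simp: inv_step_apply simple_refl_apply)

text \<open>Distant descents are independent unless \<open>z\<close> maps {i, i+1} onto {j, j+1}. If
  it does so increasingly, neither position is a descent; if decreasingly, the first step removes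
  both descents. Both sides are false in these cases.\<close>

lemma far_descents_iff:
  assumes "involution z" "Suc i < j \<or> Suc j < i"
  shows "z (Suc i) < z i \<and> inv_step z i (Suc j) < inv_step z i j \<longleftrightarrow>
    z (Suc j) < z j \<and> inv_step z j (Suc i) < inv_step z j i"
proof -
  have *: "inv_step z i j = simple_refl i (z j)" "inv_step z i (Suc j) = simple_refl i (z (Suc j))"
    "inv_step z j i = simple_refl j (z i)" "inv_step z j (Suc i) = simple_refl j (z (Suc i))"
    using assms by (auto intro: inv_step_apply_far)
  note sym = involution_sym[OF assms(1)]
  note inj = involution_eq_iff[OF assms(1)]
  consider "z j = i" "z (Suc j) = Suc i" | "z j = Suc i" "z (Suc j) = i"
    | "\<not> (z j = i \<and> z (Suc j) = Suc i)" "\<not> (z j = Suc i \<and> z (Suc j) = i)" by blast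
  then show ?thesis
  proof cases
    case 1
    then have "z i = j" "z (Suc i) = Suc j" by (simp_all add: sym)
    with 1 show ?thesis by simp
  next
    case 2
    then have "z i = Suc j" "z (Suc i) = j" by (simp_all add: sym)
    with 2 show ?thesis by (simp add: * simple_refl_apply)
  next
    case 3
    then have r: "\<not> (z i = j \<and> z (Suc i) = Suc j)" "\<not> (z i = Suc j \<and> z (Suc i) = j)"
      by (metis sym)+
    have "z i \<noteq> z (Suc i)" "z j \<noteq> z (Suc j)" by (simp_all add: inj)
    with 3 r show ?thesis unfolding * by (metis simple_refl_less_iff)
  qed
qed

text \<open>The operator \<open>u_i\<close> of the overview, acting from the right:
  \<open>lowering j (lowering i F)\<close> is \<open>F u_i u_j\<close>. The value 0 off the
  involutions lets the relations hold as equations of functions.\<close>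

definition lowering :: "nat \<Rightarrow> ((nat \<Rightarrow> nat) \<Rightarrow> 'a::comm_ring_1) \<Rightarrow> (nat \<Rightarrow> nat) \<Rightarrow> 'a" where
  "lowering i F z = (if involution z \<and> z (Suc i) < z i then F (inv_step z i) else 0)"

lemma lowering_lowering: "lowering i (lowering i F) z = 0"
  using inv_step_ascent_iff[of z i] by (auto simp: lowering_def)

lemma lowering_commute:
  assumes "Suc i < j \<or> Suc j < i"
  shows "lowering i (lowering j F) = lowering j (lowering i F)"
proof
  fix z
  have "inv_step (inv_step z i) j = inv_step (inv_step z j) i"
    using assms inv_step_commute by metis
  with far_descents_iff[OF _ assms, of z] involution_inv_step[of z]
  show "lowering i (lowering j F) z = lowering j (lowering i F) z"
    by (auto simp: lowering_def)
qed



section \<open>The braid relation of the nilCoxeter action\<close>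

lemma inv_step_descent:
  assumes "involution z" "z (Suc i) < z i"
  shows "inv_step z i = (if z i = Suc i then z \<circ> simple_refl i
    else simple_refl i \<circ> z \<circ> simple_refl i)"
  using assms by (auto simp: inv_step_apply)

context
  fixes i :: nat and z s t :: "nat \<Rightarrow> nat"
  assumes z: "involution z"
  defines "s \<equiv> simple_refl i" and "t \<equiv> simple_refl (Suc i)"
begin

private lemma s_apply: "s i = Suc i" "s (Suc i) = i" "p \<noteq> i \<Longrightarrow> p \<noteq> Suc i \<Longrightarrow> s p = p"
  and t_apply: "t (Suc i) = Suc (Suc i)" "t (Suc (Suc i)) = Suc i"
    "p \<noteq> Suc i \<Longrightarrow> p \<noteq> Suc (Suc i) \<Longrightarrow> t p = p"
  and s_eq: "s p = i \<longleftrightarrow> p = Suc i" "s p = Suc i \<longleftrightarrow> p = i" "s p = Suc (Suc i) \<longleftrightarrow> p = Suc (Suc i)"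
  and t_eq: "t p = i \<longleftrightarrow> p = i" "t p = Suc i \<longleftrightarrow> p = Suc (Suc i)" "t p = Suc (Suc i) \<longleftrightarrow> p = Suc i"
  unfolding s_def t_def simple_refl_apply by auto

private lemmas vals = s_apply(1,2) s_apply(3)[of "Suc (Suc i)"] t_apply(1,2) t_apply(3)[of i]

private lemma sym: "z i = Suc i \<longleftrightarrow> z (Suc i) = i" "z i = Suc (Suc i) \<longleftrightarrow> z (Suc (Suc i)) = i"
    "z (Suc i) = Suc (Suc i) \<longleftrightarrow> z (Suc (Suc i)) = Suc i"
  using involution_sym[OF z] by auto

private lemma distinct: "z i \<noteq> z (Suc i)" "z i \<noteq> z (Suc (Suc i))" "z (Suc i) \<noteq> z (Suc (Suc i))"
  using involution_eq_iff[OF z] by auto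

private definition "z1 \<equiv> inv_step z i"
private definition "z2 \<equiv> inv_step z1 (Suc i)"
private definition "z3 \<equiv> inv_step z2 i"
private definition "w1 \<equiv> inv_step z (Suc i)"
private definition "w2 \<equiv> inv_step w1 i"
private definition "w3 \<equiv> inv_step w2 (Suc i)"

private lemma invs: "involution z1" "involution z2" "involution w1" "involution w2"
  unfolding z1_def z2_def w1_def w2_def by (intro involution_inv_step z)+

private lemma step_z1: "z (Suc i) < z i \<Longrightarrow> z1 = (if z i = Suc i then z \<circ> s else s \<circ> z \<circ> s)"
  unfolding z1_def s_def using z by (rule inv_step_descent)

private lemma step_z2: "z1 (Suc (Suc i)) < z1 (Suc i) \<Longrightarrow>
    z2 = (if z1 (Suc i) = Suc (Suc i) then z1 \<circ> t else t \<circ> z1 \<circ> t)"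
  unfolding z2_def t_def using invs(1) by (rule inv_step_descent)

private lemma step_z3: "z2 (Suc i) < z2 i \<Longrightarrow> z3 = (if z2 i = Suc i then z2 \<circ> s else s \<circ> z2 \<circ> s)"
  unfolding z3_def s_def using invs(2) by (rule inv_step_descent)

private lemma step_w1: "z (Suc (Suc i)) < z (Suc i) \<Longrightarrow>
    w1 = (if z (Suc i) = Suc (Suc i) then z \<circ> t else t \<circ> z \<circ> t)"
  unfolding w1_def t_def using z by (rule inv_step_descent)

private lemma step_w2: "w1 (Suc i) < w1 i \<Longrightarrow> w2 = (if w1 i = Suc i then w1 \<circ> s else s \<circ> w1 \<circ> s)"
  unfolding w2_def s_def using invs(3) by (rule inv_step_descent)

private lemma step_w3: "w2 (Suc (Suc i)) < w2 (Suc i) \<Longrightarrow>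
    w3 = (if w2 (Suc i) = Suc (Suc i) then w2 \<circ> t else t \<circ> w2 \<circ> t)"
  unfolding w3_def t_def using invs(4) by (rule inv_step_descent)

private lemma s_less: "p \<noteq> q \<Longrightarrow> \<not> (p = i \<and> q = Suc i) \<Longrightarrow> \<not> (p = Suc i \<and> q = i) \<Longrightarrow> s p < s q \<longleftrightarrow> p < q"
  unfolding s_def by (rule simple_refl_less_iff)

private lemma t_less: "p \<noteq> q \<Longrightarrow> \<not> (p = Suc i \<and> q = Suc (Suc i)) \<Longrightarrow> \<not> (p = Suc (Suc i) \<and> q = Suc i) \<Longrightarrow>
    t p < t q \<longleftrightarrow> p < q"
  unfolding t_def by (rule simple_refl_less_iff)

private lemma inj_st: "s p = s q \<longleftrightarrow> p = q" "t p = t q \<longleftrightarrow> p = q"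
  unfolding s_def t_def by (metis simple_refl_simple_refl)+

text \<open>Apart from special values, each reflection keeps the order of the values compared, so
  the descents along the path pull back to \<open>z\<close>. If \<open>z\<close> exchanges
  \<open>i\<close> and \<open>i + 2\<close>, the second step is a commuting one and the third cannot
  be a descent.\<close>

private lemma chain_left:
  assumes d: "z (Suc i) < z i" "z1 (Suc (Suc i)) < z1 (Suc i)" "z2 (Suc i) < z2 i"
  shows "z (Suc (Suc i)) < z (Suc i) \<and> z (Suc (Suc i)) \<noteq> i"
proof (cases "z i = Suc i")
  case True
  then have "z (Suc i) = i" by (simp add: sym)
  then show ?thesis using d(2) True distinct step_z1[OF d(1)] by (auto simp: vals)
next
  case False
  then have ne: "z (Suc i) \<noteq> i" by (simp add: sym)
  have 1: "z1 = s \<circ> z \<circ> s" using step_z1[OF d(1)] False by simp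
  show ?thesis
  proof (cases "z i = Suc (Suc i)")
    case True
    then have c: "z (Suc (Suc i)) = i" by (simp add: sym)
    have "z2 = z1 \<circ> t" using step_z2[OF d(2)] True by (simp add: 1 vals)
    then have "Suc i < s (z (Suc i))" using d(3) c by (simp add: 1 vals)
    moreover have "z (Suc i) \<le> Suc i" using d(1) True by simp
    ultimately show ?thesis using ne
      by (cases "z (Suc i) = Suc i") (auto simp: s_apply)
  next
    case ne2: False
    then have c: "z (Suc (Suc i)) \<noteq> i" by (simp add: sym)
    have "z2 = t \<circ> z1 \<circ> t" using step_z2[OF d(2)] ne2 by (simp add: 1 vals s_eq)
    then have "t (s (z (Suc (Suc i)))) < t (s (z (Suc i)))" using d(3) by (simp add: 1 vals)
    then have "s (z (Suc (Suc i))) < s (z (Suc i))"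
      using c ne distinct by (subst (asm) t_less) (simp_all add: inj_st s_eq)
    then have "z (Suc (Suc i)) < z (Suc i)"
      using c ne distinct by (subst (asm) s_less) simp_all
    with c show ?thesis by simp
  qed
qed

text \<open>The mirror image of \<open>chain_left\<close>, with the two letters exchanged.\<close>

private lemma chain_right:
  assumes d: "z (Suc (Suc i)) < z (Suc i)" "w1 (Suc i) < w1 i" "w2 (Suc (Suc i)) < w2 (Suc i)"
  shows "z (Suc i) < z i \<and> z (Suc (Suc i)) \<noteq> i"
proof (cases "z (Suc i) = Suc (Suc i)")
  case True
  then have "z (Suc (Suc i)) = Suc i" by (simp add: sym)
  then show ?thesis using d(2) True distinct step_w1[OF d(1)] by (auto simp: vals)
next
  case False
  then have ne: "z (Suc (Suc i)) \<noteq> Suc i" by (simp add: sym)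
  have 1: "w1 = t \<circ> z \<circ> t" using step_w1[OF d(1)] False by simp
  show ?thesis
  proof (cases "z i = Suc (Suc i)")
    case True
    then have c: "z (Suc (Suc i)) = i" by (simp add: sym)
    have "w2 = w1 \<circ> s" using step_w2[OF d(2)] True by (simp add: 1 vals)
    then have "t (z (Suc i)) < Suc i" using d(3) True by (simp add: 1 vals)
    moreover have "i < z (Suc i)" using d(1) c by simp
    ultimately show ?thesis using False
      by (cases "z (Suc i) = Suc i") (auto simp: t_apply)
  next
    case ne2: False
    then have c: "z (Suc (Suc i)) \<noteq> i" by (simp add: sym)
    have "w2 = s \<circ> w1 \<circ> s" using step_w2[OF d(2)] ne2 by (simp add: 1 vals t_eq)
    then have "s (t (z (Suc i))) < s (t (z i))" using d(3) by (simp add: 1 vals)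
    then have "t (z (Suc i)) < t (z i)"
      using ne2 False distinct by (subst (asm) s_less) (auto simp: inj_st t_eq)
    then have "z (Suc i) < z i"
      using ne2 False distinct by (subst (asm) t_less) auto
    with c show ?thesis by simp
  qed
qed

text \<open>The converse of \<open>chain_left\<close> and \<open>chain_right\<close>. Both paths
  multiply \<open>z\<close> on the right by \<open>sts = tst\<close>. The left factors agree too: a
  commuting step, which drops one left factor, comes first on one path and last on the
  other.\<close>

private lemma chain_both:
  assumes d: "z (Suc i) < z i" "z (Suc (Suc i)) < z (Suc i)" "z (Suc (Suc i)) \<noteq> i"
  shows "z1 (Suc (Suc i)) < z1 (Suc i)" "z2 (Suc i) < z2 i"
    "w1 (Suc i) < w1 i" "w2 (Suc (Suc i)) < w2 (Suc i)" "z3 = w3"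
proof -
  have sts: "s (t (s p)) = t (s (t p))" for p
    unfolding s_def t_def simple_refl_apply by simp
  have a2: "z i \<noteq> Suc (Suc i)" using d(3) by (simp add: sym)
  have "z1 (Suc (Suc i)) < z1 (Suc i) \<and> z2 (Suc i) < z2 i \<and>
    w1 (Suc i) < w1 i \<and> w2 (Suc (Suc i)) < w2 (Suc i) \<and> z3 = w3"
  proof (cases "z i = Suc i")
    case True
    then have b: "z (Suc i) = i" by (simp add: sym)
    have c: "z (Suc (Suc i)) < i" using b d by simp
    have c': "s (z (Suc (Suc i))) = z (Suc (Suc i))" "t (z (Suc (Suc i))) = z (Suc (Suc i))"
      using c by (auto intro!: s_apply t_apply)
    have 1: "z1 = z \<circ> s" using step_z1[OF d(1)] True by simp
    have d1: "z1 (Suc (Suc i)) < z1 (Suc i)" using c True by (simp add: 1 vals)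
    have 2: "z2 = t \<circ> z1 \<circ> t" using step_z2[OF d1] True by (simp add: 1 vals)
    have d2: "z2 (Suc i) < z2 i" using c by (simp add: 1 2 vals b c')
    have 3: "z3 = s \<circ> z2 \<circ> s" using step_z3[OF d2] by (simp add: 1 2 vals b)
    have w1: "w1 = t \<circ> z \<circ> t" using step_w1[OF d(2)] b by simp
    have d3: "w1 (Suc i) < w1 i" using c True by (simp add: w1 vals c')
    have w2: "w2 = s \<circ> w1 \<circ> s" using step_w2[OF d3] True by (simp add: w1 vals)
    have d4: "w2 (Suc (Suc i)) < w2 (Suc i)" using True by (simp add: w1 w2 vals b)
    have w3: "w3 = w2 \<circ> t" using step_w3[OF d4] True by (simp add: w1 w2 vals)
    show ?thesis using d1 d2 d3 d4 by (simp add: 3 w3) (simp add: 1 2 w1 w2 fun_eq_iff sts)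
  next
    case ne: False
    then have bi: "z (Suc i) \<noteq> i" by (simp add: sym)
    have 1: "z1 = s \<circ> z \<circ> s" using step_z1[OF d(1)] ne by simp
    have "s (z (Suc (Suc i))) < s (z i)" using d ne distinct by (subst s_less) auto
    then have d1: "z1 (Suc (Suc i)) < z1 (Suc i)" by (simp add: 1 vals)
    have 2: "z2 = t \<circ> z1 \<circ> t" using step_z2[OF d1] a2 by (simp add: 1 vals s_eq)
    have "s (z (Suc (Suc i))) < s (z (Suc i))" using d bi distinct by (subst s_less) auto
    then have "t (s (z (Suc (Suc i)))) < t (s (z (Suc i)))"
      using d bi distinct by (subst t_less) (auto simp: inj_st s_eq)
    then have d2: "z2 (Suc i) < z2 i" by (simp add: 1 2 vals)
    show ?thesis
    proof (cases "z (Suc i) = Suc (Suc i)")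
      case True
      then have c: "z (Suc (Suc i)) = Suc i" by (simp add: sym)
      have a: "Suc (Suc i) < z i" using d True by simp
      have a': "s (z i) = z i" "t (z i) = z i" using a by (auto intro!: s_apply t_apply)
      have 3: "z3 = z2 \<circ> s" using step_z3[OF d2] True by (simp add: 1 2 vals)
      have w1: "w1 = z \<circ> t" using step_w1[OF d(2)] True by simp
      have d3: "w1 (Suc i) < w1 i" using a c by (simp add: w1 vals)
      have w2: "w2 = s \<circ> w1 \<circ> s" using step_w2[OF d3] a by (simp add: w1 vals)
      have d4: "w2 (Suc (Suc i)) < w2 (Suc i)" using a True by (simp add: w1 w2 vals a')
      have w3: "w3 = t \<circ> w2 \<circ> t" using step_w3[OF d4] a by (simp add: w1 w2 vals a')
      show ?thesis using d1 d2 d3 d4 by (simp add: 3 w3) (simp add: 1 2 w1 w2 fun_eq_iff sts)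
    next
      case False
      then have ci: "z (Suc (Suc i)) \<noteq> Suc i" by (simp add: sym)
      have 3: "z3 = s \<circ> z2 \<circ> s" using step_z3[OF d2] False by (simp add: 1 2 vals s_eq t_eq)
      have w1: "w1 = t \<circ> z \<circ> t" using step_w1[OF d(2)] False by simp
      have "t (z (Suc (Suc i))) < t (z i)" using d ci a2 distinct by (subst t_less) auto
      then have d3: "w1 (Suc i) < w1 i" by (simp add: w1 vals)
      have w2: "w2 = s \<circ> w1 \<circ> s" using step_w2[OF d3] a2 by (simp add: w1 vals t_eq)
      have "t (z (Suc i)) < t (z i)" using d False a2 distinct by (subst t_less) auto
      then have "s (t (z (Suc i))) < s (t (z i))"
        using a2 bi False distinct by (subst s_less) (auto simp: inj_st t_eq)
      then have d4: "w2 (Suc (Suc i)) < w2 (Suc i)" by (simp add: w1 w2 vals)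
      have w3: "w3 = t \<circ> w2 \<circ> t" using step_w3[OF d4] ne by (simp add: w1 w2 vals s_eq t_eq)
      show ?thesis using d1 d2 d3 d4 by (simp add: 3 w3) (simp add: 1 2 w1 w2 fun_eq_iff sts)
    qed
  qed
  then show "z1 (Suc (Suc i)) < z1 (Suc i)" "z2 (Suc i) < z2 i"
    "w1 (Suc i) < w1 i" "w2 (Suc (Suc i)) < w2 (Suc i)" "z3 = w3" by simp_all
qed

lemma lowering_braid_involution:
  "lowering i (lowering (Suc i) (lowering i F)) z =
   lowering (Suc i) (lowering i (lowering (Suc i) F)) z"
proof -
  have l: "lowering i (lowering (Suc i) (lowering i F)) z =
      (if z (Suc i) < z i \<and> z1 (Suc (Suc i)) < z1 (Suc i) \<and> z2 (Suc i) < z2 i then F z3 else 0)"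
    using z invs unfolding lowering_def z1_def[symmetric] z2_def[symmetric] z3_def[symmetric] by simp
  have r: "lowering (Suc i) (lowering i (lowering (Suc i) F)) z =
      (if z (Suc (Suc i)) < z (Suc i) \<and> w1 (Suc i) < w1 i \<and> w2 (Suc (Suc i)) < w2 (Suc i)
       then F w3 else 0)"
    using z invs unfolding lowering_def w1_def[symmetric] w2_def[symmetric] w3_def[symmetric] by simp
  show ?thesis unfolding l r using chain_left chain_right chain_both by argo
qed

end

lemma lowering_braid:
  "lowering i (lowering (Suc i) (lowering i F)) =
   lowering (Suc i) (lowering i (lowering (Suc i) F))"
proof
  show "lowering i (lowering (Suc i) (lowering i F)) z =
      lowering (Suc i) (lowering i (lowering (Suc i) F)) z" for z
    using lowering_braid_involution[of z i F] by (cases "involution z") (simp_all add: lowering_def)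
qed

section \<open>Involution words as ascending walks\<close>

primrec ascent_word :: "(nat \<Rightarrow> nat) \<Rightarrow> nat list \<Rightarrow> bool" where
  "ascent_word y [] \<longleftrightarrow> True"
| "ascent_word y (i # a) \<longleftrightarrow> y i < y (Suc i) \<and> ascent_word (inv_step y i) a"

lemma inv_act_Nil [simp]: "inv_act y [] = y"
  and inv_act_Cons [simp]: "inv_act y (i # a) = inv_act (inv_step y i) a"
  and inv_act_append: "inv_act y (a @ b) = inv_act (inv_act y a) b"
  by (simp_all add: inv_act_def)

lemma ascent_word_append:
  "ascent_word y (a @ b) \<longleftrightarrow> ascent_word y a \<and> ascent_word (inv_act y a) b"
  by (induction a arbitrary: y) auto

lemma involution_inv_act: "involution y \<Longrightarrow> involution (inv_act y a)"
  by (induction a arbitrary: y) (auto intro: involution_inv_step)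

text \<open>The last letter of an ascending walk is a descent of its end, so \<open>lowering\<close>
  removes last letters.\<close>

lemma ascent_word_snoc:
  assumes "involution y"
  shows "ascent_word y (a @ [i]) \<and> inv_act y (a @ [i]) = z \<longleftrightarrow>
    involution z \<and> z (Suc i) < z i \<and> ascent_word y a \<and> inv_act y a = inv_step z i"
  using involution_inv_act[OF assms, of a] inv_step_inv_step[of "inv_act y a" i]
    inv_step_inv_step[of z i] involution_inv_step[of "inv_act y a" i]
    inv_step_ascent_iff[of z i] inv_step_descent_iff[of "inv_act y a" i]
  by (auto simp: ascent_word_append inv_act_append)

text \<open>A step at an ascent turns it into a descent, so the same letter cannot follow.\<close>

lemma ascent_word_no_repeat:
  assumes "ascent_word y a" "involution y" "Suc j < length a"
  shows "a ! j \<noteq> a ! Suc j"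
proof
  assume eq: "a ! j = a ! Suc j"
  let ?u = "inv_act y (take j a)"
  have "a = take j a @ a ! j # a ! Suc j # drop (Suc (Suc j)) a"
    using assms(3) by (metis Cons_nth_drop_Suc Suc_lessD append_take_drop_id)
  then have "ascent_word y (take j a @ a ! j # a ! Suc j # drop (Suc (Suc j)) a)"
    using assms(1) by simp
  then have "?u (a ! j) < ?u (Suc (a ! j))"
    "inv_step ?u (a ! j) (a ! j) < inv_step ?u (a ! j) (Suc (a ! j))"
    using eq by (simp_all add: ascent_word_append)
  then show False
    using inv_step_ascent_iff[OF involution_inv_act[OF assms(2)], of "take j a" "a ! j"] by simp
qed

section \<open>A rank function and the length of involution words\<close>

definition inversions :: "(nat \<Rightarrow> nat) \<Rightarrow> (nat \<times> nat) set" where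
  "inversions w = {(a, b). a < b \<and> w b < w a}"

definition excedances :: "(nat \<Rightarrow> nat) \<Rightarrow> nat set" where
  "excedances w = {a. a < w a}"

lemma finite_inversions:
  assumes "inj w" "\<And>p. N < p \<Longrightarrow> w p = p"
  shows "finite (inversions w)"
proof (rule finite_subset)
  show "inversions w \<subseteq> {..N} \<times> {..N}"
  proof (rule subrelI)
    fix a b assume "(a, b) \<in> inversions w"
    then have ab: "a < b" "w b < w a" by (simp_all add: inversions_def)
    have "b \<le> N"
    proof (rule ccontr)
      assume "\<not> b \<le> N"
      then have "w b = b" "w (w a) = w a" using assms(2) ab by auto
      with ab injD[OF assms(1), of "w a" a] show False by simp
    qed
    with ab show "(a, b) \<in> {..N} \<times> {..N}" by simp
  qed
qed simp

text \<open>Applied to both entries, \<open>simple_refl i\<close> carries the inversions of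
  \<open>w\<close> to those of \<open>w \<circ> simple_refl i\<close> other than the new one,
  \<open>(i, Suc i)\<close>.\<close>

lemma card_inversions_ascent:
  assumes "finite (inversions w)" "w i < w (Suc i)"
  shows "card (inversions (w \<circ> simple_refl i)) = Suc (card (inversions w))"
proof -
  let ?s = "simple_refl i"
  let ?f = "map_prod ?s ?s"
  have less: "?s a < ?s b \<longleftrightarrow> a < b" if "a \<noteq> b" "(a, b) \<noteq> (i, Suc i)" "(b, a) \<noteq> (i, Suc i)" for a b
    using that by (intro simple_refl_less_iff) auto
  have "inversions (w \<circ> ?s) = insert (i, Suc i) (?f ` inversions w)"
  proof (intro equalityI subrelI)
    fix a b assume "(a, b) \<in> inversions (w \<circ> ?s)"
    then have ab: "a < b" "w (?s b) < w (?s a)" by (simp_all add: inversions_def)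
    show "(a, b) \<in> insert (i, Suc i) (?f ` inversions w)"
    proof (cases "(a, b) = (i, Suc i)")
      case False
      with ab less[of a b] have "(?s a, ?s b) \<in> inversions w" by (auto simp: inversions_def)
      then have "?f (?s a, ?s b) \<in> ?f ` inversions w" by (rule imageI)
      then show ?thesis by simp
    qed simp
  next
    fix a b assume "(a, b) \<in> insert (i, Suc i) (?f ` inversions w)"
    then consider "(a, b) = (i, Suc i)"
      | c d where "a = ?s c" "b = ?s d" "c < d" "w d < w c" by (auto simp: inversions_def)
    then show "(a, b) \<in> inversions (w \<circ> ?s)"
    proof cases
      case 1
      with assms(2) show ?thesis by (simp add: inversions_def simple_refl_apply)
    next
      case 2
      with assms(2) have "(c, d) \<noteq> (i, Suc i)" by auto
      with 2 less[of c d] show ?thesis by (auto simp: inversions_def)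
    qed
  qed
  moreover have "(i, Suc i) \<notin> ?f ` inversions w"
    by (auto simp: inversions_def simple_refl_apply split: if_splits)
  moreover have "inj ?f"
    by (intro prod.inj_map injI) (metis simple_refl_simple_refl)+
  ultimately show ?thesis
    using assms(1) by (simp add: card_image inj_on_subset)
qed

lemma card_inversions_inverse:
  assumes "\<And>p. w (u p) = p" "\<And>p. u (w p) = p"
  shows "card (inversions u) = card (inversions w)"
  by (rule bij_betw_same_card[of "\<lambda>(a, b). (u b, u a)"],
      rule bij_betw_byWitness[where f' = "\<lambda>(a, b). (w b, w a)"])
    (auto simp: inversions_def assms)

definition finitary_involution :: "(nat \<Rightarrow> nat) \<Rightarrow> bool" where
  "finitary_involution y \<longleftrightarrow> involution y \<and> y 0 = 0 \<and> (\<exists>N. \<forall>p>N. y p = p)"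

text \<open>An involution has one excedance per 2-cycle, so for involutions this is twice the
  involution length.\<close>

definition rank :: "(nat \<Rightarrow> nat) \<Rightarrow> nat" where
  "rank y = card (inversions y) + card (excedances y)"

lemma finitary_involution_inv_step:
  assumes "finitary_involution y" "1 \<le> i"
  shows "finitary_involution (inv_step y i)"
proof -
  from assms obtain N where y: "involution y" "y 0 = 0" "\<And>p. N < p \<Longrightarrow> y p = p"
    by (auto simp: finitary_involution_def)
  have "inv_step y i 0 = 0" using assms(2) y inv_step_apply_far[of y 0 i] by (simp add: simple_refl_apply)
  moreover have "inv_step y i p = p" if "N + Suc i < p" for p
    using that y inv_step_apply_far[of y p i] by (simp add: simple_refl_apply)
  ultimately show ?thesis
    using involution_inv_step[OF y(1)] unfolding finitary_involution_def by blast
qed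

lemma excedances_conjugate:
  assumes "involution y" "y i \<noteq> Suc i"
  shows "excedances (simple_refl i \<circ> y \<circ> simple_refl i) = simple_refl i ` excedances y"
proof -
  let ?s = "simple_refl i"
  have "?s q < ?s (y q) \<longleftrightarrow> q < y q" for q
  proof (cases "q = y q")
    case False
    then show ?thesis using assms involution_sym[OF assms(1), of i "Suc i"]
      by (intro simple_refl_less_iff) auto
  qed auto
  note less = this
  show ?thesis
  proof (intro equalityI subsetI)
    fix p assume "p \<in> excedances (?s \<circ> y \<circ> ?s)"
    then have "?s p \<in> excedances y" using less[of "?s p"] by (simp add: excedances_def)
    then have "?s (?s p) \<in> ?s ` excedances y" by (rule imageI)
    then show "p \<in> ?s ` excedances y" by simp
  qed (auto simp: excedances_def less)
qed

text \<open>A commuting ascent creates one inversion and one 2-cycle; a conjugating one creates two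
  inversions and only relabels the excedances.\<close>

lemma rank_ascent:
  assumes "finitary_involution y" "y i < y (Suc i)"
  shows "rank (inv_step y i) = rank y + 2"
proof -
  let ?s = "simple_refl i"
  from assms obtain N where y: "involution y" "\<And>p. N < p \<Longrightarrow> y p = p"
    by (auto simp: finitary_involution_def)
  have injs: "inj ?s" by (rule injI) (metis simple_refl_simple_refl)
  have injy: "inj y" by (rule injI) (simp add: involution_eq_iff[OF y(1)])
  have fin: "finite (inversions y)" using injy y(2) by (rule finite_inversions)
  have ne: "y i \<noteq> Suc i" using assms(2) involution_sym[OF y(1), of i "Suc i"] by auto
  have "p \<le> N" if "p \<in> excedances y" for p
    using that y(2)[of p] by (cases "N < p") (simp_all add: excedances_def)
  then have "excedances y \<subseteq> {..N}" by blast
  then have fin_exc: "finite (excedances y)" by (rule finite_subset) simp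
  have l1: "card (inversions (y \<circ> ?s)) = Suc (card (inversions y))"
    using fin assms(2) by (rule card_inversions_ascent)
  show ?thesis
  proof (cases "y i = i \<and> y (Suc i) = Suc i")
    case True
    then have step: "inv_step y i = y \<circ> ?s" by (simp add: fun_eq_iff inv_step_apply[OF y(1)])
    have "excedances (y \<circ> ?s) = insert i (excedances y)"
      using True by (auto simp: excedances_def simple_refl_apply)
    moreover have "i \<notin> excedances y" using True by (simp add: excedances_def)
    ultimately show ?thesis using l1 fin_exc by (simp add: rank_def step)
  next
    case False
    have far: "\<not> (y i = Suc i \<or> y i = i \<and> y (Suc i) = Suc i)" using False ne by simp
    have step: "inv_step y i = ?s \<circ> y \<circ> ?s"
      by (rule ext) (simp only: inv_step_apply[OF y(1)] if_not_P[OF far] comp_apply)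
    \<comment> \<open>The two permutations are inverse to each other. Hence the conjugation can be
      counted as two multiplications on the right.\<close>
    have "card (inversions (?s \<circ> y)) = card (inversions (y \<circ> ?s))"
      by (rule card_inversions_inverse) (simp_all add: involutionD[OF y(1)])
    moreover have "(?s \<circ> y) i < (?s \<circ> y) (Suc i)"
      using assms(2) ne False simple_refl_less_iff[of "y i" "y (Suc i)" i] by auto
    moreover have "finite (inversions (?s \<circ> y))"
      by (rule finite_inversions[of _ "N + Suc i"])
        (use injs injy y(2) in \<open>auto simp: inj_compose simple_refl_apply\<close>)
    ultimately have "card (inversions (?s \<circ> y \<circ> ?s)) = Suc (Suc (card (inversions y)))"
      using l1 by (simp add: card_inversions_ascent)
    moreover have "card (excedances (?s \<circ> y \<circ> ?s)) = card (excedances y)"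
      unfolding excedances_conjugate[OF y(1) ne] by (rule card_image) (rule inj_on_subset[OF injs], simp)
    ultimately show ?thesis by (simp add: rank_def step)
  qed
qed

lemma rank_descent:
  assumes "finitary_involution y" "1 \<le> i" "y (Suc i) < y i"
  shows "rank (inv_step y i) + 2 = rank y"
proof -
  have y: "involution y" using assms(1) by (simp add: finitary_involution_def)
  show ?thesis
    using rank_ascent[OF finitary_involution_inv_step[OF assms(1,2)], of i] assms(3)
    by (simp add: inv_step_inv_step[OF y] inv_step_ascent_iff[OF y])
qed

lemma rank_id: "rank id = 0"
proof -
  have "inversions id = {}" "excedances id = {}" by (auto simp: inversions_def excedances_def)
  then show ?thesis by (simp add: rank_def)
qed

text \<open>Each step changes the rank by 2, up at an ascent and down at a descent. The gain is
  maximal for the length exactly if all steps ascend, so from the identity the ascending walks are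
  the shortest words.\<close>

lemma rank_inv_act:
  assumes "finitary_involution y" "a \<in> pos_words"
  shows "if ascent_word y a then rank (inv_act y a) = rank y + 2 * length a
    else rank (inv_act y a) < rank y + 2 * length a"
  using assms
proof (induction a arbitrary: y)
  case (Cons i a)
  have i: "1 \<le> i" and a: "a \<in> pos_words" using Cons.prems(2) by (auto simp: pos_words_def)
  note IH = Cons.IH[OF finitary_involution_inv_step[OF Cons.prems(1) i] a]
  have y: "involution y" using Cons.prems(1) by (simp add: finitary_involution_def)
  have "y i \<noteq> y (Suc i)" using involution_eq_iff[OF y] by simp
  then consider "y i < y (Suc i)" | "y (Suc i) < y i" by linarith
  then show ?case
  proof cases
    case 1
    then show ?thesis using IH rank_ascent[OF Cons.prems(1) 1] by (auto split: if_splits)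
  next
    case 2
    then show ?thesis using IH rank_descent[OF Cons.prems(1) i 2] by (auto split: if_splits)
  qed
qed simp

lemma involution_ascending_eq_id:
  assumes "involution y" "\<And>i. y i < y (Suc i)"
  shows "y = id"
proof
  fix p
  have mono: "strict_mono y" using assms(2) by (simp add: strict_mono_Suc_iff)
  have "p \<le> y p" "y p \<le> y (y p)" using strict_mono_imp_increasing[OF mono] by blast+
  then show "y p = id p" using involutionD[OF assms(1), of p] by simp
qed

text \<open>Walking down along descents lowers the rank, and only the identity has no
  descent.\<close>

lemma ex_ascent_word:
  assumes "finitary_involution z"
  shows "\<exists>a\<in>pos_words. ascent_word id a \<and> inv_act id a = z"
  using assms
proof (induction "rank z" arbitrary: z rule: less_induct)
  case less
  have z: "involution z" "z 0 = 0" using less.prems by (simp_all add: finitary_involution_def)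
  show ?case
  proof (cases "\<forall>i. z i < z (Suc i)")
    case True
    then have "z = id" using involution_ascending_eq_id z(1) by blast
    then show ?thesis by (intro bexI[of _ "[]"]) (simp_all add: pos_words_def)
  next
    case False
    then obtain i where "\<not> z i < z (Suc i)" by blast
    then have i: "z (Suc i) < z i" using involution_eq_iff[OF z(1), of i "Suc i"] by simp
    \<comment> \<open>\<open>z\<close> takes its least value 0 at 0, so the descent is not at 0 and
      its index is a legal letter.\<close>
    then have i1: "1 \<le> i" using z(2) by (cases i) auto
    obtain a where a: "a \<in> pos_words" "ascent_word id a" "inv_act id a = inv_step z i"
      using less.hyps[OF _ finitary_involution_inv_step[OF less.prems i1]]
        rank_descent[OF less.prems i1 i] by auto
    then have "ascent_word id (a @ [i]) \<and> inv_act id (a @ [i]) = z"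
      using ascent_word_snoc[OF involution_id, of a i z] z(1) i by simp
    moreover have "a @ [i] \<in> pos_words" using a(1) i1 by (auto simp: pos_words_def)
    ultimately show ?thesis by blast
  qed
qed

lemma finitary_involution_id: "finitary_involution id"
  by (simp add: finitary_involution_def involution_id)

lemma inv_words_eq:
  assumes "finitary_involution z"
  shows "inv_words z = {a \<in> pos_words. ascent_word id a \<and> inv_act id a = z}"
proof -
  have rank: "if ascent_word id a then rank z = 2 * length a else rank z < 2 * length a"
    if "a \<in> pos_words" "inv_act id a = z" for a
    using rank_inv_act[OF finitary_involution_id that(1)] that(2) by (simp add: rank_id split: if_splits)
  obtain b where b: "b \<in> pos_words" "ascent_word id b" "inv_act id b = z"
    using ex_ascent_word[OF assms] by blast
  show ?thesis
  proof (intro equalityI subsetI)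
    fix a assume "a \<in> inv_words z"
    then have a: "a \<in> pos_words" "inv_act id a = z" "length a \<le> length b"
      using b by (auto simp: inv_words_def)
    with rank[OF a(1,2)] rank[OF b(1,3)] b(2) show "a \<in> {a \<in> pos_words. ascent_word id a \<and> inv_act id a = z}"
      by (auto split: if_splits)
  next
    fix a assume "a \<in> {a \<in> pos_words. ascent_word id a \<and> inv_act id a = z}"
    then have a: "a \<in> pos_words" "inv_act id a = z" "ascent_word id a" by simp_all
    have "length a \<le> length c" if "c \<in> pos_words" "inv_act id c = z" for c
      using rank[OF a(1,2)] rank[OF that] a(3) by (auto split: if_splits)
    with a show "a \<in> inv_words z" by (simp add: inv_words_def)
  qed
qed

lemma rel_inv_words_eq:
  assumes "finitary_involution v" "finitary_involution z"
  shows "rel_inv_words v z = {a \<in> pos_words. ascent_word v a \<and> inv_act v a = z}"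
proof -
  obtain b where b: "b \<in> inv_words v"
    using ex_ascent_word[OF assms(1)] by (auto simp: inv_words_eq[OF assms(1)])
  have "a \<in> rel_inv_words v z \<longleftrightarrow> a \<in> pos_words \<and> ascent_word v a \<and> inv_act v a = z" for a
    using b unfolding rel_inv_words_indep[OF b]
    by (auto simp: inv_words_eq assms pos_words_def ascent_word_append inv_act_append)
  then show ?thesis by blast
qed

text \<open>The last letter is a descent of \<open>z\<close>, and \<open>z\<close> has no descent
  from \<open>N\<close> on. Removing it leaves an involution that still fixes everything above
  \<open>N\<close>.\<close>

lemma ascent_word_letters:
  assumes "involution v" "ascent_word v a" "inv_act v a = z" "\<And>p. N < p \<Longrightarrow> z p = p"
  shows "\<forall>i\<in>set a. i < N"
  using assms(2-4)
proof (induction a arbitrary: z rule: rev_induct)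
  case (snoc i a)
  then have z: "involution z" "z (Suc i) < z i" "ascent_word v a" "inv_act v a = inv_step z i"
    using ascent_word_snoc[OF assms(1), of a i z] by auto
  have i: "i < N"
  proof (rule ccontr)
    assume "\<not> i < N"
    then have "z (Suc i) = Suc i" "z (z i) = z i" using snoc.prems(3) z(2) by auto
    then show False using z(2) by (simp add: involution_eq_iff[OF z(1)])
  qed
  have "inv_step z i p = p" if "N < p" for p
    using that i snoc.prems(3)[OF that] inv_step_apply_far[OF z(1), of p i]
    by (simp add: simple_refl_apply)
  with snoc.IH[OF z(3,4)] i show ?case by simp
qed simp

section \<open>The nilCoxeter action and the Yang--Baxter equation\<close>

definition raising :: "nat \<Rightarrow> 'a::comm_ring_1 \<Rightarrow> ((nat \<Rightarrow> nat) \<Rightarrow> 'a) \<Rightarrow> (nat \<Rightarrow> nat) \<Rightarrow> 'a" where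
  "raising i x F z = F z + x * lowering i F z"

lemma lowering_raising:
  "lowering i (raising j x F) z = lowering i F z + x * lowering i (lowering j F) z"
  by (simp add: lowering_def raising_def)

lemma lowering_raising_fun:
  "lowering i (\<lambda>z. F z + x * G z) z = lowering i F z + x * lowering i G z"
  by (simp add: lowering_def)

lemma raising_raising_same: "raising i y (raising i x F) = raising i (x + y) F"
  by (rule ext) (simp add: raising_def[of i y] raising_def[of i "x + y"] lowering_raising
    lowering_lowering raising_def algebra_simps)

lemma raising_commute_if:
  assumes "lowering i (lowering j F) = lowering j (lowering i F)"
  shows "raising i x (raising j y F) = raising j y (raising i x F)"
  using assms
  by (intro ext) (simp add: raising_def[of i x "raising j y F"] raising_def[of j y "raising i x F"]
    lowering_raising raising_def algebra_simps)

lemma raising_commute: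
  assumes "Suc i < j \<or> Suc j < i"
  shows "raising i x (raising j y F) = raising j y (raising i x F)"
  by (rule raising_commute_if) (rule lowering_commute[OF assms])

text \<open>Both sides are expanded in \<open>u_i\<close> and \<open>u_{i+1}\<close>. The linear and
  mixed quadratic coefficients agree because the middle parameter is the sum of the outer ones,
  squares vanish, and the cubic terms match by the braid relation.\<close>

lemma raising_yang_baxter:
  "raising i y (raising (Suc i) (x + y) (raising i x F)) =
   raising (Suc i) x (raising i (x + y) (raising (Suc i) y F))"
proof
  fix z
  have e: "raising i c (raising j b (raising k a F)) z =
    F z + a * lowering k F z + b * lowering j F z + c * lowering i F z
    + a * b * lowering j (lowering k F) z + a * c * lowering i (lowering k F) z
    + b * c * lowering i (lowering j F) z + a * b * c * lowering i (lowering j (lowering k F)) z"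
    for i j k and a b c :: 'a
  proof -
    have "raising j b (raising k a F) =
      (\<lambda>z. raising k a F z + b * (\<lambda>z. lowering j F z + a * lowering j (lowering k F) z) z)"
      by (rule ext) (simp add: raising_def[of j] lowering_raising)
    then show ?thesis
      by (simp only: raising_def[of i] lowering_raising_fun lowering_raising)
        (simp add: raising_def algebra_simps)
  qed
  show "raising i y (raising (Suc i) (x + y) (raising i x F)) z =
   raising (Suc i) x (raising i (x + y) (raising (Suc i) y F)) z"
    unfolding e by (simp add: lowering_lowering lowering_braid algebra_simps)
qed

text \<open>A list stands for a product of factors \<open>h_i(x)\<close> acting from the right; its
  head acts first.\<close>

definition raise :: "(nat \<times> 'a::comm_ring_1) list \<Rightarrow> ((nat \<Rightarrow> nat) \<Rightarrow> 'a) \<Rightarrow> (nat \<Rightarrow> nat) \<Rightarrow> 'a" where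
  "raise = fold (\<lambda>(i, x). raising i x)"

lemma raise_Nil [simp]: "raise [] F = F"
  and raise_Cons [simp]: "raise ((i, x) # w) F = raise w (raising i x F)"
  and raise_append [simp]: "raise (w @ w') F = raise w' (raise w F)"
  by (simp_all add: raise_def)

lemma raise_raising_commute:
  assumes "\<And>j y. (j, y) \<in> set w \<Longrightarrow> Suc i < j \<or> Suc j < i"
  shows "raise w (raising i x F) = raising i x (raise w F)"
  using assms
proof (induction w arbitrary: F)
  case (Cons a w)
  obtain j y where a: "a = (j, y)" by (cases a)
  have "raising j y (raising i x F) = raising i x (raising j y F)"
    using Cons.prems[of j y] a by (intro raising_commute) auto
  moreover have "raise w (raising i x (raising j y F)) = raising i x (raise w (raising j y F))"
    using Cons.prems by (intro Cons.IH) auto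
  ultimately show ?case by (simp add: a)
qed simp

text \<open>The product \<open>B_k(x)\<close> of the overview; \<open>descending\<close> is
  \<open>A_k(x)\<close>.\<close>

definition ascending :: "nat \<Rightarrow> nat \<Rightarrow> 'a \<Rightarrow> (nat \<times> 'a) list" where
  "ascending N k x = map (\<lambda>i. (i, x)) [k..<N]"

definition descending :: "nat \<Rightarrow> nat \<Rightarrow> 'a \<Rightarrow> (nat \<times> 'a) list" where
  "descending N k x = map (\<lambda>i. (i, x)) (rev [k..<N])"

lemma ascending_Cons: "k < N \<Longrightarrow> ascending N k x = (k, x) # ascending N (Suc k) x"
  by (simp add: ascending_def upt_conv_Cons)

lemma descending_snoc: "k < N \<Longrightarrow> descending N k x = descending N (Suc k) x @ [(k, x)]"
  by (simp add: descending_def upt_conv_Cons)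

lemma ascending_Nil [simp]: "N \<le> k \<Longrightarrow> ascending N k x = []"
  and descending_Nil [simp]: "N \<le> k \<Longrightarrow> descending N k x = []"
  by (simp_all add: ascending_def descending_def)

lemma in_set_ascending [simp]: "(j, y) \<in> set (ascending N k x) \<longleftrightarrow> k \<le> j \<and> j < N \<and> y = x"
  and in_set_descending [simp]: "(j, y) \<in> set (descending N k x) \<longleftrightarrow> k \<le> j \<and> j < N \<and> y = x"
  by (auto simp: ascending_def descending_def)

lemma raise_ascending_descending:
  assumes "k < N"
  shows "raise (ascending N k x @ descending N k y) F =
    raise (descending N (Suc k) y @ (k, x + y) # ascending N (Suc k) x) F"
  using assms
proof (induction "N - Suc k" arbitrary: k F)
  case 0
  then have "N = Suc k" by simp
  then show ?case
    by (simp add: ascending_Cons descending_snoc raising_raising_same)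
next
  case (Suc d)
  then have k: "Suc k < N" and d: "d = N - Suc (Suc k)" by simp_all
  let ?D = "raise (descending N (Suc (Suc k)) y)" and ?A = "raise (ascending N (Suc (Suc k)) x)"
  have D: "?D (raising k z G) = raising k z (?D G)" for z G
    by (rule raise_raising_commute) auto
  have A: "?A (raising k z G) = raising k z (?A G)" for z G
    by (rule raise_raising_commute) auto
  have "raise (ascending N k x @ descending N k y) F =
    raising k y (raise (ascending N (Suc k) x @ descending N (Suc k) y) (raising k x F))"
    using Suc.prems by (simp add: ascending_Cons[of k] descending_snoc[of k])
  also have "\<dots> = raising k y (?A (raising (Suc k) (x + y) (?D (raising k x F))))"
    using Suc.hyps(1)[OF d k, of "raising k x F"] by simp
  \<comment> \<open>The letter \<open>k\<close> commutes with all letters from \<open>k + 2\<close>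
    on, which brings the three factors of the Yang--Baxter equation together.\<close>
  also have "\<dots> = ?A (raising k y (raising (Suc k) (x + y) (raising k x (?D F))))"
    by (simp add: D A)
  also have "\<dots> = ?A (raising (Suc k) x (raising k (x + y) (raising (Suc k) y (?D F))))"
    by (simp only: raising_yang_baxter)
  also have "\<dots> = raise (descending N (Suc k) y @ (k, x + y) # ascending N (Suc k) x) F"
    using k by (simp add: ascending_Cons[of "Suc k"] descending_snoc[of "Suc k"])
  finally show ?case .
qed

definition staircase :: "nat \<Rightarrow> nat \<Rightarrow> (nat \<Rightarrow> 'a) \<Rightarrow> (nat \<times> 'a) list" where
  "staircase N k Y = concat (map (\<lambda>i. descending N i (Y i)) [k..<N])"

lemma staircase_Nil [simp]: "N \<le> k \<Longrightarrow> staircase N k Y = []"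
  by (simp add: staircase_def)

lemma staircase_Cons: "k < N \<Longrightarrow> staircase N k Y = descending N k (Y k) @ staircase N (Suc k) Y"
  by (simp add: staircase_def upt_conv_Cons)

lemma in_set_staircase:
  "(j, y) \<in> set (staircase N k Y) \<longleftrightarrow> (\<exists>i. k \<le> i \<and> i \<le> j \<and> j < N \<and> y = Y i)"
  by (auto simp: staircase_def)

text \<open>The ascending run is pushed through the staircase one run at a time by
  \<open>raise_ascending_descending\<close>. Every run loses its lowest letter, hence the index
  shift in \<open>Y\<close>, and leaves behind one factor with parameter \<open>x + Y i\<close>,
  which commutes with the later shortened runs.\<close>

lemma raise_ascending_staircase:
  "raise (ascending N k x @ staircase N k Y) F =
   raise (staircase N (Suc k) (\<lambda>i. Y (i - 1)) @ map (\<lambda>i. (i, x + Y i)) [k..<N]) F"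
proof (induction "N - k" arbitrary: k F)
  case 0
  then show ?case by simp
next
  case (Suc d)
  then have k: "k < N" and d: "d = N - Suc k" by simp_all
  have "raise (ascending N k x @ staircase N k Y) F =
    raise (staircase N (Suc k) Y) (raise (ascending N k x @ descending N k (Y k)) F)"
    using k by (simp add: staircase_Cons[of k])
  also have "\<dots> = raise (ascending N (Suc k) x @ staircase N (Suc k) Y)
      (raising k (x + Y k) (raise (descending N (Suc k) (Y k)) F))"
    by (simp only: raise_ascending_descending[OF k]) simp
  also have "\<dots> = raise (map (\<lambda>i. (i, x + Y i)) [Suc k..<N])
      (raise (staircase N (Suc (Suc k)) (\<lambda>i. Y (i - 1)))
        (raising k (x + Y k) (raise (descending N (Suc k) (Y k)) F)))"
    using Suc.hyps(1)[OF d] by simp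
  also have "raise (staircase N (Suc (Suc k)) (\<lambda>i. Y (i - 1))) (raising k (x + Y k) G) =
      raising k (x + Y k) (raise (staircase N (Suc (Suc k)) (\<lambda>i. Y (i - 1))) G)" for G
    by (rule raise_raising_commute) (auto simp: in_set_staircase)
  also have "raise (map (\<lambda>i. (i, x + Y i)) [Suc k..<N]) (raising k (x + Y k)
      (raise (staircase N (Suc (Suc k)) (\<lambda>i. Y (i - 1))) (raise (descending N (Suc k) (Y k)) F))) =
    raise (staircase N (Suc k) (\<lambda>i. Y (i - 1)) @ map (\<lambda>i. (i, x + Y i)) [k..<N]) F"
    using k by (cases "Suc k < N") (simp_all add: upt_conv_Cons staircase_Cons[of "Suc k"])
  finally show ?case .
qed

definition delta :: "(nat \<Rightarrow> nat) \<Rightarrow> (nat \<Rightarrow> nat) \<Rightarrow> 'a::comm_ring_1" where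
  "delta v z = (if z = v then 1 else 0)"

text \<open>Steps are self-inverse and exchange ascents with descents, so the only \<open>z\<close>
  that can step down to \<open>v\<close> is \<open>inv_step v i\<close>.\<close>

lemma lowering_delta:
  assumes "involution v"
  shows "lowering i (delta v) = (if v i < v (Suc i) then delta (inv_step v i) else (\<lambda>z. 0))"
proof
  fix z
  have "involution z \<and> z (Suc i) < z i \<and> inv_step z i = v \<longleftrightarrow> v i < v (Suc i) \<and> z = inv_step v i"
    using assms inv_step_inv_step[of z i] inv_step_inv_step[of v i] involution_inv_step[of v i]
      inv_step_ascent_iff[of z i] by metis
  then show "lowering i (delta v) z = (if v i < v (Suc i) then delta (inv_step v i) else (\<lambda>z. 0)) z"
    by (auto simp: lowering_def delta_def)
qed

section \<open>The two starting points\<close>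

lemma inv_step_id: "inv_step id i = simple_refl i"
  by (simp add: inv_step_def)

text \<open>From the identity both orders of the two letters lead to the transposition of
  \<open>i\<close> and \<open>i + 2\<close>.\<close>

lemma raising_commute_delta_id:
  "raising i x (raising (Suc i) y (delta id)) = raising (Suc i) y (raising i x (delta id))"
proof (rule raising_commute_if)
  have "inv_step (simple_refl (Suc i)) i = inv_step (simple_refl i) (Suc i)"
    by (rule ext, subst (1 2) inv_step_apply)
      (simp_all add: involution_simple_refl, simp add: simple_refl_apply)
  then show "lowering i (lowering (Suc i) (delta id)) = lowering (Suc i) (lowering i (delta id))"
    by (simp add: lowering_delta involution_id involution_simple_refl inv_step_id)
      (simp add: simple_refl_apply)
qed

text \<open>The letter \<open>k\<close> moves to the front of the run: it commutes with the letters
  from \<open>k + 2\<close> on, and with \<open>k + 1\<close> when both act directly on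
  \<open>delta id\<close>.\<close>

lemma raise_descending_delta_id:
  "raise (descending N k x) (delta id) = raise (ascending N k x) (delta id)"
proof (induction "N - k" arbitrary: k)
  case (Suc d)
  then have k: "k < N" and d: "d = N - Suc k" by simp_all
  have "raise (descending N k x) (delta id) = raising k x (raise (ascending N (Suc k) x) (delta id))"
    using Suc.hyps(1)[OF d] k by (simp add: descending_snoc[of k])
  also have "\<dots> = raise (ascending N k x) (delta id)"
  proof (cases "Suc k < N")
    case True
    have "raise (ascending N (Suc (Suc k)) x) (raising k x (raising (Suc k) x (delta id))) =
      raising k x (raise (ascending N (Suc k) x) (delta id))"
      using True by (simp add: ascending_Cons[of "Suc k"]) (rule raise_raising_commute, auto)
    with True k show ?thesis
      by (simp add: raising_commute_delta_id ascending_Cons[of k] ascending_Cons[of "Suc k"])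
  next
    case False
    with k show ?thesis by (simp add: ascending_Cons[of k])
  qed
  finally show ?case .
qed simp

text \<open>Since \<open>w s_i = s_j w\<close>, one has
  \<open>s_i w s_i = s_i s_j w = s_j w s_j\<close>.\<close>

lemma inv_step_conjugate:
  assumes "involution w" "w i = j" "w (Suc i) = Suc j" "Suc i < j"
  shows "inv_step w i = inv_step w j"
proof
  fix p
  have w: "w j = i" "w (Suc j) = Suc i" using assms by (metis involution_def)+
  have "w (simple_refl i p) = simple_refl j (w p)" "w (simple_refl j p) = simple_refl i (w p)" for p
    using assms(2,3) w involution_eq_iff[OF assms(1), of p i] involution_eq_iff[OF assms(1), of p j]
      involution_eq_iff[OF assms(1), of p "Suc i"] involution_eq_iff[OF assms(1), of p "Suc j"]
    by (auto simp: simple_refl_apply)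
  moreover have "simple_refl i (simple_refl j q) = simple_refl j (simple_refl i q)" for q
    using assms(4) by (auto simp: simple_refl_apply)
  ultimately show "inv_step w i p = inv_step w j p"
    using assms w by (simp add: inv_step_apply)
qed

lemma min_fpf_odd: "odd i \<Longrightarrow> i < 2 * n \<Longrightarrow> min_fpf n i = Suc i"
  and min_fpf_Suc_odd: "odd i \<Longrightarrow> i < 2 * n \<Longrightarrow> min_fpf n (Suc i) = i"
  and min_fpf_beyond: "2 * n < i \<Longrightarrow> min_fpf n i = i"
  and min_fpf_0: "min_fpf n 0 = 0"
  by (auto simp: min_fpf_def elim!: oddE)

lemma involution_min_fpf: "involution (min_fpf n)"
  unfolding involution_def
proof
  fix p
  have "p = 0 \<or> 2 * n < p \<or> odd p \<and> p < 2 * n \<or> (\<exists>q. p = Suc q \<and> odd q \<and> q < 2 * n)"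
    by (cases p) presburger+
  then show "min_fpf n (min_fpf n p) = p"
    by (auto simp: min_fpf_odd min_fpf_Suc_odd min_fpf_beyond min_fpf_0)
qed

lemma raising_delta_min_fpf:
  assumes "odd k" "k < 2 * n"
  shows "raising k x (delta (min_fpf n)) = delta (min_fpf n)"
  using assms by (auto simp: raising_def lowering_delta involution_min_fpf min_fpf_odd min_fpf_Suc_odd)

text \<open>\<open>u_k\<close> and \<open>u_{k+2}\<close> annihilate the starting vector. After the
  ascent at \<open>k + 1\<close> the two 2-cycles cross, and then the letters \<open>k\<close> and
  \<open>k + 2\<close> have the same effect by \<open>inv_step_conjugate\<close>.\<close>

lemma raising_raising_delta_min_fpf:
  fixes x y :: "'a::comm_ring_1"
  assumes "odd k" "Suc (Suc k) < 2 * n"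
  shows "raising k y (raising (Suc k) x (delta (min_fpf n))) =
    raising (Suc (Suc k)) y (raising (Suc k) x (delta (min_fpf n)))"
proof -
  let ?v = "min_fpf n" and ?e = "delta (min_fpf n) :: _ \<Rightarrow> 'a"
  let ?w = "inv_step ?v (Suc k)"
  have v: "?v k = Suc k" "?v (Suc k) = k" "?v (Suc (Suc k)) = Suc (Suc (Suc k))"
    "?v (Suc (Suc (Suc k))) = Suc (Suc k)"
    using assms by (simp_all add: min_fpf_odd min_fpf_Suc_odd)
  have w: "?w k = Suc (Suc k)" "?w (Suc k) = Suc (Suc (Suc k))" "?w (Suc (Suc k)) = k"
    "?w (Suc (Suc (Suc k))) = Suc k"
    using v by (simp_all add: inv_step_apply involution_min_fpf simple_refl_apply)
  have inv: "involution ?w" by (intro involution_inv_step involution_min_fpf)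
  have "inv_step ?w k = inv_step ?w (Suc (Suc k))"
    using w by (intro inv_step_conjugate inv) simp_all
  then have "lowering k (lowering (Suc k) ?e) =
      lowering (Suc (Suc k)) (lowering (Suc k) ?e)"
    using v w inv by (simp add: lowering_delta involution_min_fpf)
  moreover have "lowering k ?e = lowering (Suc (Suc k)) ?e"
    using v by (simp add: lowering_delta involution_min_fpf)
  ultimately show ?thesis
    by (intro ext) (simp add: raising_def[of k] raising_def[of "Suc (Suc k)"] lowering_raising)
qed

text \<open>Induction in steps of two. Once the part from \<open>k + 2\<close> on has become an
  ascending run from \<open>k + 3\<close>, the letters \<open>k + 1\<close> and \<open>k\<close>
  move in front of it, and \<open>raising_raising_delta_min_fpf\<close> replaces \<open>k\<close> by
  \<open>k + 2\<close>.\<close>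

lemma raise_descending_delta_min_fpf:
  assumes "odd k"
  shows "raise (descending (2 * n) k x) (delta (min_fpf n)) =
    raise (ascending (2 * n) (Suc k) x) (delta (min_fpf n))"
  using assms
proof (induction "2 * n - k" arbitrary: k rule: less_induct)
  case less
  let ?e = "delta (min_fpf n)" and ?N = "2 * n"
  have "k \<noteq> ?N" using less.prems by auto
  then consider "k > ?N" | "?N = Suc k" | "Suc k < ?N" by linarith
  then show ?case
  proof cases
    case 2
    then show ?thesis using less.prems
      by (simp add: descending_snoc[of k] raising_delta_min_fpf)
  next
    case 3
    moreover have "Suc (Suc k) \<noteq> ?N" using less.prems by presburger
    ultimately have k: "Suc (Suc k) < ?N" by simp
    let ?A = "raise (ascending ?N (Suc (Suc (Suc k))) x)"
    have A: "?A (raising i x G) = raising i x (?A G)" if "i \<le> Suc k" for G i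
      using that by (intro raise_raising_commute) auto
    have "raise (descending ?N k x) ?e =
      raising k x (raising (Suc k) x (raise (descending ?N (Suc (Suc k)) x) ?e))"
      using k by (simp add: descending_snoc[of k] descending_snoc[of "Suc k"])
    also have "\<dots> = ?A (raising k x (raising (Suc k) x ?e))"
      using less.hyps[of "Suc (Suc k)"] k less.prems by (simp flip: A)
    also have "\<dots> = raise (ascending ?N (Suc k) x) ?e"
      using k less.prems
      by (simp add: raising_raising_delta_min_fpf ascending_Cons[of "Suc k"] ascending_Cons[of "Suc (Suc k)"])
    finally show ?thesis .
  qed simp
qed

section \<open>Rows of the diagram\<close>

lemma raise_no_descent:
  assumes "\<And>i x. (i, x) \<in> set w \<Longrightarrow> \<not> y (Suc i) < y i"
  shows "raise w F y = F y"
  using assms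
proof (induction w arbitrary: F)
  case (Cons a w)
  obtain i x where a: "a = (i, x)" by (cases a)
  have "raise (a # w) F y = raising i x F y"
    using Cons.IH[of "raising i x F"] Cons.prems by (auto simp: a)
  also have "\<dots> = F y" using Cons.prems[of i x] by (simp add: a raising_def lowering_def)
  finally show ?case .
qed simp

text \<open>A nonzero value at \<open>z\<close> arises from a point of the support of
  \<open>F\<close> by a sequence of steps, so a property of the support that survives the steps
  persists.\<close>

lemma raise_nonzeroD:
  assumes "\<And>z. F z \<noteq> 0 \<Longrightarrow> P z"
    and "\<And>i x z. (i, x) \<in> set w \<Longrightarrow> involution z \<Longrightarrow> P z \<Longrightarrow> P (inv_step z i)"
    and "raise w F z \<noteq> 0"
  shows "P z"
  using assms
proof (induction w arbitrary: F)
  case (Cons a w)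
  obtain i x where a: "a = (i, x)" by (cases a)
  have "P z" if "raising i x F z \<noteq> 0" for z
  proof (cases "F z = 0")
    case True
    with that have "involution z" "F (inv_step z i) \<noteq> 0"
      by (auto simp: raising_def lowering_def split: if_splits)
    then show ?thesis
      using Cons.prems(1)[of "inv_step z i"] Cons.prems(2)[of i x "inv_step z i"] a
        inv_step_inv_step[of z i] involution_inv_step[of z i] by simp
  qed (use Cons.prems in blast)
  with Cons.prems a show ?case by (intro Cons.IH[of "raising i x F"]) auto
qed simp

text \<open>The offset \<open>e\<close> is \<open>0\<close> for words starting at the identity and \<open>1\<close> for words starting at the minimal
  fixed-point-free involution; \<open>X i\<close> is the value substituted for \<open>x\<^sub>i\<close>, and the letters are below \<open>N\<close>.
  After \<open>m\<close> rows, position \<open>2 m + i\<close> belongs to the variable \<open>x\<close> with index \<open>m + i\<close>.\<close>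

locale involution_start =
  fixes N e :: nat and v :: "nat \<Rightarrow> nat" and X :: "nat \<Rightarrow> 'a::comm_ring_1"
  assumes involution_v: "involution v"
    and v_beyond: "N < p \<Longrightarrow> v p = p"
    and v_even: "even c \<Longrightarrow> c \<le> N \<Longrightarrow> p \<le> c \<Longrightarrow> v p \<le> c"
    and start: "odd k \<Longrightarrow> raise (descending N k x) (delta v) =
      (raise (ascending N (k + e) x) (delta v) :: _ \<Rightarrow> 'a)"
    and start_cases: "e = 0 \<and> v = id \<or>
      e = 1 \<and> even N \<and> (\<forall>m. 2 * m + 1 < N \<longrightarrow> v (2 * m + 1) = 2 * m + 2)"
begin

text \<open>The product of the overview once \<open>m\<close> rows are split off: the runs start at
  \<open>2 * m + 1\<close> and their variables at \<open>m + 1\<close>.\<close>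

definition stage :: "nat \<Rightarrow> (nat \<Rightarrow> nat) \<Rightarrow> 'a" where
  "stage m = raise (staircase N (2 * m + 1) (\<lambda>i. X (i - m))) (delta v)"

definition row_head :: "nat \<Rightarrow> (nat \<times> 'a) list" where
  "row_head m = (if e = 0 then [(2 * m + 1, X (m + 1))] else [])"

definition row_tail :: "nat \<Rightarrow> nat \<Rightarrow> nat \<Rightarrow> (nat \<times> 'a) list" where
  "row_tail m k l = map (\<lambda>i. (i, X (m + 1) + X (i - m))) [k..<l]"

lemma stage_eq:
  assumes "2 * m + 1 < N"
  shows "stage m = raise (row_head m @ row_tail m (2 * m + 2) N) (stage (m + 1))"
proof -
  let ?x = "X (m + 1)" and ?Y = "\<lambda>i. X (i - m)" and ?k = "2 * m + 1"
  have "stage m = raise (staircase N (?k + 1) ?Y) (raise (descending N ?k ?x) (delta v))"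
    by (simp only: stage_def staircase_Cons[OF assms] raise_append) simp
  \<comment> \<open>The hypothesis \<open>start\<close> reverses the first run and drops its lowest
    letter if \<open>e = 1\<close>.\<close>
  also have "\<dots> = raise (ascending N (?k + e) ?x @ staircase N (?k + 1) ?Y) (delta v)"
    by (simp add: start)
  finally have stage: "stage m = raise (ascending N (?k + e) ?x @ staircase N (?k + 1) ?Y) (delta v)" .
  have tail: "raise (ascending N (?k + 1) ?x @ staircase N (?k + 1) ?Y) F =
      raise (row_tail m (2 * m + 2) N) (raise (staircase N (2 * (m + 1) + 1) (\<lambda>i. X (i - (m + 1)))) F)" for F
    using raise_ascending_staircase[of N "?k + 1" ?x ?Y F] by (simp add: row_tail_def)
  show ?thesis
  proof (cases "e = 0")
    case True
    have "stage m = raise (ascending N (?k + 1) ?x @ staircase N (?k + 1) ?Y) (raising ?k ?x (delta v))"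
      using True assms by (simp add: stage ascending_Cons[of "Suc (2 * m)"])
    also have "\<dots> = raise (row_tail m (2 * m + 2) N)
        (raise (staircase N (2 * (m + 1) + 1) (\<lambda>i. X (i - (m + 1)))) (raising ?k ?x (delta v)))"
      by (rule tail)
    \<comment> \<open>Only letters from \<open>2 * m + 3\<close> on occur in this staircase, so the
      letter of the diagonal cell commutes with it.\<close>
    also have "raise (staircase N (2 * (m + 1) + 1) (\<lambda>i. X (i - (m + 1)))) (raising ?k ?x (delta v)) =
        raising ?k ?x (stage (m + 1))"
      unfolding stage_def by (rule raise_raising_commute) (auto simp: in_set_staircase)
    finally show ?thesis unfolding row_head_def using True by simp
  next
    case False
    then have e: "e = 1" using start_cases by simp
    have "stage m = raise (ascending N (?k + 1) ?x @ staircase N (?k + 1) ?Y) (delta v)"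
      unfolding stage e ..
    also have "\<dots> = raise (row_tail m (2 * m + 2) N) (stage (m + 1))"
      unfolding stage_def by (rule tail)
    finally show ?thesis unfolding row_head_def using False by simp
  qed
qed

lemma v_even_Suc:
  assumes "2 * m + 1 < N"
  shows "v (2 * m + 1) = 2 * m + 1 + e"
  using start_cases assms by auto

text \<open>All letters of the staircase exceed \<open>2 * m\<close>, and \<open>v\<close> preserves
  the positions up to \<open>2 * m\<close>, so no step changes the values there.\<close>

lemma stage_nonzeroD:
  assumes "stage m z \<noteq> 0" "2 * m \<le> N" "p \<le> 2 * m"
  shows "z p = v p"
proof -
  let ?P = "\<lambda>z. \<forall>p \<le> 2 * m. z p = v p"
  have "?P z"
  proof (rule raise_nonzeroD[of "delta v" ?P])
    show "raise (staircase N (2 * m + 1) (\<lambda>i. X (i - m))) (delta v) z \<noteq> 0"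
      using assms(1) by (simp add: stage_def)
    show "?P z" if "delta v z \<noteq> (0 :: 'a)" for z
      using that by (simp add: delta_def split: if_splits)
    show "?P (inv_step z i)"
      if "(i, x) \<in> set (staircase N (2 * m + 1) (\<lambda>i. X (i - m)))" "involution z" "?P z" for i x z
    proof (intro allI impI)
      fix p assume p: "p \<le> 2 * m"
      have i: "2 * m < i" using that(1) by (auto simp: in_set_staircase)
      have "inv_step z i p = simple_refl i (v p)"
        using that p i inv_step_apply_far[of z p i] by simp
      also have "\<dots> = v p"
        using v_even[of "2 * m" p] assms(2) p i by (simp add: simple_refl_apply)
      finally show "inv_step z i p = v p" .
    qed
  qed
  with assms(3) show ?thesis by simp
qed

text \<open>Before the tail acts, the partner of \<open>2 * m + 1\<close> is at most
  \<open>2 * m + 2\<close>, and each letter of the tail raises it by at most one. This bound kills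
  the terms that omit a letter of the row.\<close>

lemma row_nonzeroD:
  assumes m: "2 * m + 1 < N"
    and nz: "raise (row_head m @ row_tail m (2 * m + 2) (2 * m + 2 + j)) (stage (m + 1)) z \<noteq> 0"
  shows "z (2 * m + 1) \<le> 2 * m + 2 + j"
  using nz
proof (induction j arbitrary: z)
  case 0
  let ?k = "2 * m + 1"
  have nz: "raise (row_head m) (stage (m + 1)) z \<noteq> 0"
    using "0" by (simp add: row_tail_def)
  have m2: "2 * (m + 1) \<le> N" using m by simp
  show ?case
  proof (cases "stage (m + 1) z = 0")
    case False
    then have "z ?k = v ?k" using stage_nonzeroD[OF False m2, of ?k] by simp
    with v_even_Suc[OF m] start_cases show ?thesis by auto
  next
    case True
    have e: "e = 0" using nz True by (cases "e = 0") (simp_all add: row_head_def)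
    with start_cases have v: "v = id" by simp
    have "row_head m = [(?k, X (m + 1))]" unfolding row_head_def using e by simp
    with nz True have z: "involution z" and nz': "stage (m + 1) (inv_step z ?k) \<noteq> 0"
      by (auto simp: raising_def lowering_def split: if_splits)
    let ?y = "inv_step z ?k"
    have y: "?y ?k = ?k" "?y (Suc ?k) = Suc ?k"
      using stage_nonzeroD[OF nz' m2, of ?k] stage_nonzeroD[OF nz' m2, of "Suc ?k"] v by simp_all
    have "z ?k = inv_step ?y ?k ?k" using inv_step_inv_step[OF z] by simp
    also have "\<dots> = Suc ?k"
      using y by (subst inv_step_apply) (simp_all add: involution_inv_step z simple_refl_apply)
    finally show ?thesis by simp
  qed
next
  case (Suc j)
  let ?k = "2 * m + 1" and ?i = "2 * m + 2 + j"
  let ?P = "raise (row_head m @ row_tail m (2 * m + 2) (2 * m + 2 + j)) (stage (m + 1))"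
  have nz: "raising ?i (X (m + 1) + X (?i - m)) ?P z \<noteq> 0"
    using Suc.prems by (simp add: row_tail_def)
  show ?case
  proof (cases "?P z = 0")
    case False
    then show ?thesis using Suc.IH[OF False] by simp
  next
    case True
    with nz have z: "involution z" and nz': "?P (inv_step z ?i) \<noteq> 0"
      by (auto simp: raising_def lowering_def split: if_splits)
    have "z ?k = inv_step (inv_step z ?i) ?i ?k" using inv_step_inv_step[OF z] by simp
    also have "\<dots> = simple_refl ?i (inv_step z ?i ?k)"
      by (rule inv_step_apply_far) (simp_all add: involution_inv_step z)
    also have "\<dots> \<le> Suc ?i" using Suc.IH[OF nz'] by (auto simp: simple_refl_apply)
    finally show ?thesis by simp
  qed
qed

text \<open>Peeling off the factors of a row conjugates the involution by the cycle that moves the partner of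
  the first free position next to it, and thus standardizes the remaining positions.\<close>

definition shift_pos :: "nat \<Rightarrow> nat \<Rightarrow> nat" where
  "shift_pos k p = (if p \<le> k then p - 1 else p)"

text \<open>The partner of \<open>2 * m + 1\<close> is as far away as the \<open>j\<close> letters
  of the tail allow. By \<open>row_nonzeroD\<close> the term that omits the last letter vanishes;
  the term that takes it has the weight of that letter as a factor and moves the partner down by
  one.\<close>

lemma peel_tail:
  assumes m: "2 * m + 1 < N" and y: "involution y" "y (2 * m + 1) = 2 * m + 2 + j"
    and low: "\<And>p. p \<le> 2 * m \<Longrightarrow> y p = v p"
  obtains z where "involution z" "z (2 * m + 1) = 2 * m + 2" "\<And>p. p \<le> 2 * m \<Longrightarrow> z p = v p"
    "\<And>p. 2 * m + 2 < p \<Longrightarrow> 2 * m + 2 < z p \<and> shift_pos (2 * m + 2 + j) (z p) = y (shift_pos (2 * m + 2 + j) p)"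
    "raise (row_head m @ row_tail m (2 * m + 2) (2 * m + 2 + j)) (stage (m + 1)) y =
     (\<Prod>i = 2 * m + 2..<2 * m + 2 + j. X (m + 1) + X (i - m)) * raise (row_head m) (stage (m + 1)) z"
  using y low
proof (induction j arbitrary: y thesis)
  case 0
  show ?case
  proof (rule "0"(1)[of y])
    fix p assume p: "2 * m + 2 < p"
    have y2: "y (2 * m + 2) = 2 * m + 1" using "0"(2,3) by (simp add: involution_sym)
    have low: "y q \<le> 2 * m" if "q \<le> 2 * m" for q
      using that "0"(4) v_even[of "2 * m" q] m by simp
    have "\<not> y p \<le> 2 * m + 2"
    proof
      assume "y p \<le> 2 * m + 2"
      then consider "y p \<le> 2 * m" | "y p = 2 * m + 1" | "y p = 2 * m + 2" by linarith
      then show False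
      proof cases
        case 1
        from low[OF this] p show False by (simp add: involutionD[OF "0"(2)])
      next
        case 2
        then have "p = y (2 * m + 1)" using involutionD[OF "0"(2), of p] by simp
        with "0"(3) p show False by simp
      next
        case 3
        then have "p = y (2 * m + 2)" using involutionD[OF "0"(2), of p] by simp
        with y2 p show False by simp
      qed
    qed
    then show "2 * m + 2 < y p \<and> shift_pos (2 * m + 2 + 0) (y p) = y (shift_pos (2 * m + 2 + 0) p)"
      using p by (simp add: shift_pos_def)
  qed (use "0" in \<open>simp_all add: row_tail_def\<close>)
next
  case (Suc j)
  let ?k = "2 * m + 1" and ?i = "2 * m + 2 + j"
  let ?P = "raise (row_head m @ row_tail m (2 * m + 2) (2 * m + 2 + j)) (stage (m + 1))"
  let ?s = "simple_refl ?i"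
  note y = Suc.prems(2)
  have yk: "y ?k = Suc ?i" using Suc.prems(3) by simp
  have yi: "y (Suc ?i) = ?k" using yk y by (simp add: involution_sym)
  have low: "y p \<le> 2 * m" if "p \<le> 2 * m" for p
    using that Suc.prems(4) v_even[of "2 * m" p] m by simp
  \<comment> \<open>The value \<open>?k\<close> at \<open>Suc ?i\<close> is the least one beyond
    \<open>2 * m\<close>, so \<open>?i\<close> is a descent.\<close>
  have "y ?i \<noteq> ?k" using yi involution_eq_iff[OF y, of ?i "Suc ?i"] by simp
  moreover have "\<not> y ?i \<le> 2 * m" using low[of "y ?i"] involutionD[OF y, of ?i] by auto
  ultimately have desc: "y (Suc ?i) < y ?i" using yi by simp
  have far: "\<not> (y ?i = Suc ?i \<or> y ?i = ?i \<and> y (Suc ?i) = Suc ?i)"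
    using yi yk involution_eq_iff[OF y, of ?i ?k] by simp
  have step: "inv_step y ?i p = ?s (y (?s p))" for p
    unfolding inv_step_apply[OF y] if_not_P[OF far] ..
  have zero: "?P y = 0" using row_nonzeroD[OF m, of j y] yk by force
  have "raise (row_head m @ row_tail m (2 * m + 2) (2 * m + 2 + Suc j)) (stage (m + 1)) y =
      raising ?i (X (m + 1) + X (?i - m)) ?P y"
    by (simp add: row_tail_def)
  also have "\<dots> = (X (m + 1) + X (?i - m)) * ?P (inv_step y ?i)"
    using y desc zero by (simp add: raising_def lowering_def)
  finally have val: "raise (row_head m @ row_tail m (2 * m + 2) (2 * m + 2 + Suc j)) (stage (m + 1)) y =
      (X (m + 1) + X (?i - m)) * ?P (inv_step y ?i)" .
  have inv: "involution (inv_step y ?i)" by (intro involution_inv_step y)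
  have k: "inv_step y ?i ?k = 2 * m + 2 + j" unfolding step using yk by (simp add: simple_refl_apply)
  have v: "inv_step y ?i p = v p" if "p \<le> 2 * m" for p
    unfolding step using that low[OF that] Suc.prems(4)[OF that] by (simp add: simple_refl_apply)
  obtain z where z: "involution z" "z ?k = 2 * m + 2" "\<And>p. p \<le> 2 * m \<Longrightarrow> z p = v p"
    "\<And>p. 2 * m + 2 < p \<Longrightarrow> 2 * m + 2 < z p \<and> shift_pos ?i (z p) = inv_step y ?i (shift_pos ?i p)"
    "?P (inv_step y ?i) =
     (\<Prod>i = 2 * m + 2..<2 * m + 2 + j. X (m + 1) + X (i - m)) * raise (row_head m) (stage (m + 1)) z"
    using Suc.IH[OF _ inv k v] by blast
  \<comment> \<open>The reflection turns the standardization for \<open>?i\<close> into the one for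
    \<open>Suc ?i\<close>.\<close>
  have s: "?s (shift_pos ?i p) = shift_pos (2 * m + 2 + Suc j) p" if "2 * m + 2 < p" for p
    using that by (auto simp: shift_pos_def simple_refl_apply)
  show ?case
  proof (rule Suc.prems(1)[OF z(1-3)])
    fix p assume p: "2 * m + 2 < p"
    have "?s (shift_pos ?i (z p)) = y (?s (shift_pos ?i p))"
      unfolding conjunct2[OF z(4)[OF p]] step by simp
    then show "2 * m + 2 < z p \<and>
        shift_pos (2 * m + 2 + Suc j) (z p) = y (shift_pos (2 * m + 2 + Suc j) p)"
      unfolding s[OF p] s[OF conjunct1[OF z(4)[OF p]]] using z(4)[OF p] by blast
  next
    have prod: "(\<Prod>i = a..<a + Suc j. f i) = f (a + j) * (\<Prod>i = a..<a + j. f i)" for a and f :: "nat \<Rightarrow> 'a"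
      by (simp add: mult.commute)
    show "raise (row_head m @ row_tail m (2 * m + 2) (2 * m + 2 + Suc j)) (stage (m + 1)) y =
     (\<Prod>i = 2 * m + 2..<2 * m + 2 + Suc j. X (m + 1) + X (i - m)) * raise (row_head m) (stage (m + 1)) z"
      unfolding val z(5) prod mult.assoc ..
  qed
qed


text \<open>Letters from the partner of \<open>2 * m + 1\<close> on meet no descent and contribute
  nothing; the letters before it are forced by \<open>peel_tail\<close>. What remains is a 2-cycle
  on \<open>2 * m + 1\<close> and \<open>2 * m + 2\<close>. If \<open>e = 0\<close>, the head letter
  removes it with weight \<open>X (m + 1)\<close>; if \<open>e = 1\<close>, it is a cycle of
  \<open>v\<close>.\<close>

lemma peel_row:
  assumes m: "2 * m + 1 < N" and y: "involution y" "y (2 * m + 1) = 2 * m + 1 + k" "0 < k"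
    and low: "\<And>p. p \<le> 2 * m \<Longrightarrow> y p = v p"
    and high: "\<And>p. N < p \<Longrightarrow> y p = p"
    and no_descent: "\<And>i. 2 * m + 1 + k \<le> i \<Longrightarrow> \<not> y (Suc i) < y i"
  obtains z where "involution z" "\<And>p. p \<le> 2 * m + 2 \<Longrightarrow> z p = v p"
    "\<And>p. 2 * m + 2 < p \<Longrightarrow> 2 * m + 2 < z p \<and> shift_pos (2 * m + 1 + k) (z p) = y (shift_pos (2 * m + 1 + k) p)"
    "stage m y = (if e = 0 then X (m + 1) else 1) *
       (\<Prod>i = 2 * m + 2..<2 * m + 1 + k. X (m + 1) + X (i - m)) * stage (m + 1) z"
proof -
  let ?k = "2 * m + 1"
  obtain j where j: "k = Suc j" using y(3) by (cases k) auto
  have "2 * m + 1 + k \<le> N"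
  proof (rule ccontr)
    assume "\<not> 2 * m + 1 + k \<le> N"
    then have "y (y ?k) = y ?k" using y(2) high by simp
    then show False using y(2,3) involution_eq_iff[OF y(1)] by simp
  qed
  then have "2 * m + 2 + j \<le> N" using j by simp
  have upt: "[a..<c] = [a..<b] @ [b..<c]" if "a \<le> b" "b \<le> c" for a b c :: nat
    using upt_add_eq_append[OF that(1), of "c - b"] that(2) by simp
  have split: "row_tail m (2 * m + 2) N =
      row_tail m (2 * m + 2) (2 * m + 2 + j) @ row_tail m (2 * m + 2 + j) N"
    unfolding row_tail_def upt[OF le_add1 \<open>2 * m + 2 + j \<le> N\<close>] map_append ..
  have "stage m y = raise (row_tail m (2 * m + 2 + j) N)
      (raise (row_head m @ row_tail m (2 * m + 2) (2 * m + 2 + j)) (stage (m + 1))) y"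
    unfolding stage_eq[OF m] split by simp
  also have "\<dots> = raise (row_head m @ row_tail m (2 * m + 2) (2 * m + 2 + j)) (stage (m + 1)) y"
  proof (rule raise_no_descent)
    fix i x assume "(i, x) \<in> set (row_tail m (2 * m + 2 + j) N)"
    then show "\<not> y (Suc i) < y i" using no_descent[of i] j by (auto simp: row_tail_def)
  qed
  finally have 1: "stage m y = raise (row_head m @ row_tail m (2 * m + 2) (2 * m + 2 + j)) (stage (m + 1)) y" .
  have yk: "y ?k = 2 * m + 2 + j" using y(2) j by simp
  obtain w where w: "involution w" "w ?k = 2 * m + 2" "\<And>p. p \<le> 2 * m \<Longrightarrow> w p = v p"
    "\<And>p. 2 * m + 2 < p \<Longrightarrow> 2 * m + 2 < w p \<and> shift_pos (2 * m + 2 + j) (w p) = y (shift_pos (2 * m + 2 + j) p)"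
    "raise (row_head m @ row_tail m (2 * m + 2) (2 * m + 2 + j)) (stage (m + 1)) y =
     (\<Prod>i = 2 * m + 2..<2 * m + 2 + j. X (m + 1) + X (i - m)) * raise (row_head m) (stage (m + 1)) w"
    using peel_tail[OF m y(1) yk low] by blast
  have w2: "w (2 * m + 2) = ?k" using w(1,2) by (simp add: involution_sym)
  have upto: "p \<le> 2 * m \<or> p = ?k \<or> p = 2 * m + 2" if "p \<le> 2 * m + 2" for p using that by linarith
  show ?thesis
  proof (cases "e = 0")
    case True
    with start_cases have v: "v = id" by simp
    let ?z = "inv_step w ?k"
    have z: "?z p = w (simple_refl ?k p)" for p
      using w(2) by (simp add: inv_step_apply[OF w(1)])
    have rh: "row_head m = [(?k, X (m + 1))]" unfolding row_head_def using True by simp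
    \<comment> \<open>The support of \<open>stage (m + 1)\<close> consists of functions fixing
      \<open>2 * m + 1\<close>, which \<open>w\<close> moves. So only the term that takes the head
      letter survives.\<close>
    have "stage (m + 1) w = 0"
      using stage_nonzeroD[of "m + 1" w ?k] m w(2) v by fastforce
    then have 2: "raise (row_head m) (stage (m + 1)) w = X (m + 1) * stage (m + 1) ?z"
      using w(1,2) w2 by (simp add: rh raising_def lowering_def)
    show ?thesis
    proof (rule that)
      show "involution ?z" by (intro involution_inv_step w)
      show "?z p = v p" if "p \<le> 2 * m + 2" for p
        unfolding z using upto[OF that] w(2,3) w2 v by (auto simp: simple_refl_apply)
      show "2 * m + 2 < ?z p \<and> shift_pos (2 * m + 1 + k) (?z p) = y (shift_pos (2 * m + 1 + k) p)"
        if "2 * m + 2 < p" for p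
        unfolding z using w(4)[OF that] that j by (simp add: simple_refl_apply)
      show "stage m y = (if e = 0 then X (m + 1) else 1) *
       (\<Prod>i = 2 * m + 2..<2 * m + 1 + k. X (m + 1) + X (i - m)) * stage (m + 1) ?z"
        unfolding 1 w(5) 2 using True j by (simp add: mult_ac)
    qed
  next
    case False
    then have e: "e = 1" using start_cases by simp
    have vk: "v ?k = 2 * m + 2" using v_even_Suc[OF m] e by simp
    then have "v (2 * m + 2) = ?k" using involution_v by (simp add: involution_sym)
    note v2 = vk this
    have 2: "raise (row_head m) (stage (m + 1)) w = stage (m + 1) w"
      unfolding row_head_def using False by simp
    show ?thesis
    proof (rule that[OF w(1)])
      show "w p = v p" if "p \<le> 2 * m + 2" for p
        using upto[OF that] w(2,3) w2 v2 by auto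
      show "2 * m + 2 < w p \<and> shift_pos (2 * m + 1 + k) (w p) = y (shift_pos (2 * m + 1 + k) p)"
        if "2 * m + 2 < p" for p
        using w(4)[OF that] j by simp
      show "stage m y = (if e = 0 then X (m + 1) else 1) *
       (\<Prod>i = 2 * m + 2..<2 * m + 1 + k. X (m + 1) + X (i - m)) * stage (m + 1) w"
        unfolding 1 w(5) 2 using False j by simp
    qed
  qed
qed

section \<open>Dominance and the first column of the diagram\<close>

definition dominant_beyond :: "nat \<Rightarrow> (nat \<Rightarrow> nat) \<Rightarrow> bool" where
  "dominant_beyond c y \<longleftrightarrow>
    (\<forall>i j k. c < i \<longrightarrow> i < j \<longrightarrow> j < k \<longrightarrow> \<not> (y i < y k \<and> y k < y j))"

text \<open>The offset \<open>e\<close> covers both diagrams: for \<open>c = 0\<close> this is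
  \<open>inv_diagram y\<close> if \<open>e = 0\<close> and \<open>fpf_diagram y\<close> if
  \<open>e = 1\<close>.\<close>

definition diagram_beyond :: "nat \<Rightarrow> (nat \<Rightarrow> nat) \<Rightarrow> (nat \<times> nat) set" where
  "diagram_beyond c y = {(i, j). c < j \<and> j + e \<le> i \<and> j < y i \<and> i < y j}"

text \<open>The first part is column \<open>2 * m + 1\<close>. By dominance all other cells also lie
  in rows smaller than \<open>2 * m + 1 + k\<close>, where undoing \<open>shift_pos\<close> adds 1,
  so they are the cells of \<open>z\<close> with both coordinates lowered by one.\<close>

lemma diagram_beyond_step:
  assumes y: "involution y" "y (2 * m + 1) = 2 * m + 1 + k" "0 < k"
    and pres: "\<And>p. 2 * m < p \<Longrightarrow> 2 * m < y p"
    and dom: "dominant_beyond (2 * m) y" and e: "e \<le> 1"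
    and z: "\<And>p. 2 * m + 2 < p \<Longrightarrow>
      2 * m + 2 < z p \<and> shift_pos (2 * m + 1 + k) (z p) = y (shift_pos (2 * m + 1 + k) p)"
  shows "diagram_beyond (2 * m) y =
    (\<lambda>i. (i, 2 * m + 1)) ` {2 * m + 1 + e..<2 * m + 1 + k} \<union>
    (\<lambda>(i, j). (i - 1, j - 1)) ` diagram_beyond (2 * m + 2) z" (is "?D = ?R \<union> ?S")
proof -
  let ?c = "2 * m" and ?\<pi> = "shift_pos (2 * m + 1 + k)"
  have yk: "y (?c + 1 + k) = ?c + 1" using y by (simp add: involution_sym)
  \<comment> \<open>A cell in a later row would give a 132-pattern at the positions
    \<open>?c + 1 + k\<close>, \<open>i\<close>, \<open>y j\<close>, with the values
    \<open>?c + 1\<close>, \<open>y i\<close>, \<open>j\<close>.\<close>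
  have small: "i < ?c + 1 + k" if "?c < i" "?c < j" "j < y i" "i < y j" for i j
  proof (rule ccontr)
    assume i: "\<not> i < ?c + 1 + k"
    have "i \<noteq> ?c + 1 + k" using that yk by auto
    with i have i: "?c + 1 + k < i" by simp
    have "y (?c + 1 + k) < y (y j)"
      using that yk i y involutionD[OF y(1), of j] by (cases "j = ?c + 1") auto
    then show False
      using dom[unfolded dominant_beyond_def, rule_format, of "?c + 1 + k" i "y j"] i that
      by (simp add: involutionD[OF y(1)])
  qed
  have \<pi>_less: "?\<pi> p < ?\<pi> q \<longleftrightarrow> p < q" if "?c + 2 < p" "?c + 2 < q" for p q
    using that by (auto simp: shift_pos_def)
  have \<pi>_gt: "?c + 1 < ?\<pi> p" if "?c + 2 < p" for p using that by (auto simp: shift_pos_def)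
  have D'_iff: "?\<pi> q < y (?\<pi> p) \<longleftrightarrow> q < z p" if "?c + 2 < p" "?c + 2 < q" for p q
    using \<pi>_less[OF that(2), of "z p"] z[OF that(1)] by simp
  show ?thesis
  proof (intro equalityI subsetI)
    fix a assume "a \<in> ?D"
    then obtain i j where a: "a = (i, j)" and ij: "?c < j" "j + e \<le> i" "j < y i" "i < y j"
      by (auto simp: diagram_beyond_def)
    show "a \<in> ?R \<union> ?S"
    proof (cases "j = ?c + 1")
      case True
      then show ?thesis using a ij y(2) by auto
    next
      case False
      with ij have ij': "?c + 1 < i" "?c + 1 < j" by auto
      have "i < ?c + 1 + k" using small[of i j] ij ij' by simp
      then have "?\<pi> (i + 1) = i" "?\<pi> (j + 1) = j" using ij by (auto simp: shift_pos_def)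
      then have "j + 1 < z (i + 1)" "i + 1 < z (j + 1)"
        using D'_iff[of "i + 1" "j + 1"] D'_iff[of "j + 1" "i + 1"] ij ij' by simp_all
      then have "(i + 1, j + 1) \<in> diagram_beyond (?c + 2) z"
        using ij ij' by (simp add: diagram_beyond_def)
      then have "(\<lambda>(i, j). (i - 1, j - 1)) (i + 1, j + 1) \<in> ?S" by (rule imageI)
      then show ?thesis by (simp add: a)
    qed
  next
    fix a assume "a \<in> ?R \<union> ?S"
    then show "a \<in> ?D"
    proof
      assume "a \<in> ?R"
      then obtain i where a: "a = (i, ?c + 1)" and i: "?c + 1 + e \<le> i" "i < ?c + 1 + k" by auto
      have "?c < y i" using pres i by simp
      moreover have "y i \<noteq> ?c + 1" using yk i involution_eq_iff[OF y(1), of i "?c + 1 + k"] by auto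
      ultimately show ?thesis using i y(2) by (simp add: a diagram_beyond_def)
    next
      assume "a \<in> ?S"
      then obtain i j where a: "a = (i - 1, j - 1)" and
        ij: "?c + 2 < j" "j + e \<le> i" "j < z i" "i < z j"
        by (auto simp: diagram_beyond_def)
      then have i: "?c + 2 < i" by simp
      have lt: "?\<pi> j < y (?\<pi> i)" "?\<pi> i < y (?\<pi> j)"
        using D'_iff[OF i, of j] D'_iff[of j, OF _ i] ij by simp_all
      then have "?\<pi> i < ?c + 1 + k"
        using small[of "?\<pi> i" "?\<pi> j"] \<pi>_gt[OF i] \<pi>_gt[of j] ij by simp
      then have "i \<le> ?c + 1 + k" by (auto simp: shift_pos_def split: if_splits)
      then have "?\<pi> i = i - 1" "?\<pi> j = j - 1" using ij by (auto simp: shift_pos_def)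
      then show ?thesis using lt ij by (auto simp: a diagram_beyond_def)
    qed
  qed
qed

text \<open>\<open>shift_pos\<close> preserves the order beyond \<open>2 * m + 2\<close>, so a
  132-pattern of \<open>z\<close> would yield one of \<open>y\<close>.\<close>

lemma dominant_beyond_step:
  assumes dom: "dominant_beyond (2 * m) y"
    and z: "\<And>p. 2 * m + 2 < p \<Longrightarrow> 2 * m + 2 < z p \<and> shift_pos k (z p) = y (shift_pos k p)"
  shows "dominant_beyond (2 * m + 2) z"
  unfolding dominant_beyond_def
proof (intro allI impI notI)
  fix p q r assume pqr: "2 * m + 2 < p" "p < q" "q < r" and pat: "z p < z r \<and> z r < z q"
  have less: "shift_pos k a < shift_pos k b" if "2 * m + 2 < a" "a < b" for a b
    using that by (auto simp: shift_pos_def)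
  have "y (shift_pos k p) < y (shift_pos k r)" "y (shift_pos k r) < y (shift_pos k q)"
    using z[of p] z[of q] z[of r] pqr pat less[of "z p" "z r"] less[of "z r" "z q"] by simp_all
  moreover have "2 * m < shift_pos k p" using pqr by (auto simp: shift_pos_def)
  moreover have "shift_pos k p < shift_pos k q" "shift_pos k q < shift_pos k r"
    using pqr less by simp_all
  ultimately show False using dom unfolding dominant_beyond_def by blast
qed

text \<open>A diagonal cell stems from the single factor in \<open>row_head\<close> and weighs
  \<open>X i\<close> rather than \<open>X i + X i\<close>; this is the source of the power of 2 in
  the first formula.\<close>

definition cell_weight :: "nat \<Rightarrow> nat \<Rightarrow> 'a" where
  "cell_weight i j = (if i = j then X i else X i + X j)"

text \<open>Induction over the rows. The first free position lies beyond all letters, or is fixed,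
  or has a partner; in the last case \<open>peel_row\<close> supplies the weights of one column and
  \<open>diagram_beyond_step\<close> the remaining cells.\<close>

lemma stage_dominant:
  assumes "2 * m \<le> N" "involution y" "\<And>p. p \<le> 2 * m \<Longrightarrow> y p = v p" "\<And>p. N < p \<Longrightarrow> y p = p"
    "dominant_beyond (2 * m) y" "\<And>p. e = 1 \<Longrightarrow> 0 < p \<Longrightarrow> p \<le> N \<Longrightarrow> y p \<noteq> p"
  shows "finite (diagram_beyond (2 * m) y) \<and>
    stage m y = (\<Prod>(i, j)\<in>diagram_beyond (2 * m) y. cell_weight (i - m) (j - m))"
  using assms
proof (induction "N - 2 * m" arbitrary: m y rule: less_induct)
  case less
  note y = less.prems(2) and low = less.prems(3) and high = less.prems(4) and dom = less.prems(5)
  have low': "y p \<le> 2 * m" if "p \<le> 2 * m" for p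
    using that low v_even[of "2 * m" p] less.prems(1) by simp
  have pres: "2 * m < y p" if "2 * m < p" for p
    using low'[of "y p"] that involutionD[OF y, of p] by force
  have trivial: ?case if fixed: "\<And>p. 2 * m < p \<Longrightarrow> y p = p" and val: "stage m y = 1"
  proof -
    have "diagram_beyond (2 * m) y = {}" using fixed by (auto simp: diagram_beyond_def)
    with val show ?thesis by simp
  qed
  let ?k = "2 * m + 1"
  consider "N \<le> ?k" | "?k < N" "y ?k = ?k" | "?k < N" "y ?k \<noteq> ?k" by linarith
  then show ?case
  proof cases
    case 1
    have fixed: "y p = p" if "2 * m < p" for p
    proof (cases "p = N")
      case True
      show ?thesis
      proof (rule ccontr)
        assume "y p \<noteq> p"
        moreover have "y p \<ge> p" using pres[OF that] 1 True by simp
        ultimately have "y (y p) = y p" using high True by simp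
        with \<open>y p \<noteq> p\<close> show False by (simp add: involution_eq_iff[OF y])
      qed
    qed (use that 1 high in simp)
    have "v p = p" if "2 * m < p" for p
      using start_cases
    proof
      \<comment> \<open>As \<open>N\<close> is even, only \<open>N = 2 * m\<close> is left, and
        \<open>v\<close> fixes everything beyond.\<close>
      assume "e = 1 \<and> even N \<and> (\<forall>m. 2 * m + 1 < N \<longrightarrow> v (2 * m + 1) = 2 * m + 2)"
      then have "N \<noteq> ?k" by auto
      with 1 that show ?thesis by (intro v_beyond) simp
    qed simp
    then have "y = v" using fixed low by (metis ext not_le)
    then have "stage m y = 1" using 1 by (simp add: stage_def delta_def)
    with fixed show ?thesis by (rule trivial)
  next
    case 2
    with less.prems(6)[of ?k] start_cases have v: "e = 0" "v = id" by auto
    \<comment> \<open>The fixed point \<open>?k\<close> followed by a descent would be a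
      132-pattern, so dominance leaves only the identity.\<close>
    have asc: "y i < y (Suc i)" for i
    proof (cases "i \<le> ?k")
      case True
      then have "y i = i" using low v 2 by (cases "i = ?k") auto
      moreover have "i < y (Suc i)"
      proof (cases "Suc i \<le> 2 * m")
        case False
        then have "2 * m < y (Suc i)" using pres by simp
        moreover have "y (Suc i) \<noteq> ?k" if "i = ?k"
          using that 2 involution_eq_iff[OF y, of "Suc i" i] by simp
        ultimately show ?thesis using True False by (cases "i = ?k") auto
      qed (use low v in simp)
      ultimately show ?thesis by simp
    next
      case False
      have "y ?k < y (Suc i)"
        using pres[of "Suc i"] False 2 involution_eq_iff[OF y, of "Suc i" ?k] by (cases "y (Suc i) = ?k") auto
      then have "\<not> y (Suc i) < y i"
        using dom[unfolded dominant_beyond_def, rule_format, of ?k i "Suc i"] False by simp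
      then show ?thesis using involution_eq_iff[OF y, of i "Suc i"] by simp
    qed
    have id: "y = id" by (rule involution_ascending_eq_id[OF y asc])
    have "stage m y = delta v y"
      unfolding stage_def by (rule raise_no_descent) (simp add: id)
    then have "stage m y = 1" by (simp add: delta_def id v)
    then show ?thesis by (intro trivial) (simp_all add: id)
  next
    case 3
    have "?k \<le> y ?k" using pres[of ?k] by simp
    then obtain k where k: "y ?k = ?k + k" by (rule le_Suc_ex[THEN exE]) simp
    then have k0: "0 < k" using 3 by simp
    have yk: "y (?k + k) = ?k" using k y by (simp add: involution_sym)
    \<comment> \<open>The partner of \<open>?k\<close> carries the least remaining value, so no
      descent starts there, and one further right would complete a 132-pattern.\<close>
    have no_desc: "\<not> y (Suc i) < y i" if "?k + k \<le> i" for i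
    proof (cases "i = ?k + k")
      case True
      then show ?thesis using yk pres[of "Suc i"] by simp
    next
      case False
      have "2 * m < y (Suc i)" using pres[of "Suc i"] that by simp
      moreover have "y (Suc i) \<noteq> ?k" using yk that involution_eq_iff[OF y, of "Suc i" "?k + k"] by auto
      ultimately show ?thesis
        using dom[unfolded dominant_beyond_def, rule_format, of "?k + k" i "Suc i"] False that yk by simp
    qed
    obtain z where z: "involution z" "\<And>p. p \<le> 2 * m + 2 \<Longrightarrow> z p = v p"
      "\<And>p. 2 * m + 2 < p \<Longrightarrow> 2 * m + 2 < z p \<and> shift_pos (?k + k) (z p) = y (shift_pos (?k + k) p)"
      "stage m y = (if e = 0 then X (m + 1) else 1) *
         (\<Prod>i = 2 * m + 2..<?k + k. X (m + 1) + X (i - m)) * stage (m + 1) z"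
      using peel_row[OF 3(1) y k k0 low high no_desc] by blast
    have kN: "?k + k \<le> N"
    proof (rule ccontr)
      assume "\<not> ?k + k \<le> N"
      then have "y (?k + k) = ?k + k" using high by simp
      with yk k0 show False by simp
    qed
    have zhigh: "z p = p" if "N < p" for p
    proof -
      have "shift_pos (?k + k) (z p) = p" using z(3)[of p] that kN 3(1) high[OF that]
        by (simp add: shift_pos_def)
      then show ?thesis using that kN by (auto simp: shift_pos_def split: if_splits)
    qed
    have zfree: "z p \<noteq> p" if "e = 1" "0 < p" "p \<le> N" for p
    proof (cases "p \<le> 2 * m + 2")
      case True
      have "v p \<noteq> p"
      proof (cases "p \<le> 2 * m")
        case True
        then show ?thesis using low[of p] less.prems(6)[of p] that by simp
      next
        case False
        have "v ?k = 2 * m + 2" using start_cases that(1) 3(1) by simp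
        moreover then have "v (2 * m + 2) = ?k" using involution_v by (simp add: involution_sym)
        moreover have "p = ?k \<or> p = 2 * m + 2" using False True by linarith
        ultimately show ?thesis by auto
      qed
      with z(2)[OF True] show ?thesis by simp
    next
      case False
      then have p: "2 * m + 2 < p" by simp
      have "0 < shift_pos (?k + k) p" "shift_pos (?k + k) p \<le> N" using p that by (auto simp: shift_pos_def)
      then show ?thesis using less.prems(6)[of "shift_pos (?k + k) p"] z(3)[OF p] that(1) by auto
    qed
    have dom': "dominant_beyond (2 * (m + 1)) z"
      using dominant_beyond_step[OF dom z(3)] by simp
    have IH: "finite (diagram_beyond (2 * m + 2) z)"
      "stage (m + 1) z = (\<Prod>(i, j)\<in>diagram_beyond (2 * m + 2) z. cell_weight (i - (m + 1)) (j - (m + 1)))"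
      using less.hyps[of "m + 1" z] 3(1) z(1,2) zhigh dom' zfree by auto
    have e: "e \<le> 1" using start_cases by auto
    let ?D = "diagram_beyond (2 * m) y" and ?D' = "diagram_beyond (2 * m + 2) z"
    let ?R = "(\<lambda>i. (i, ?k)) ` {?k + e..<?k + k}" and ?S = "(\<lambda>(i, j). (i - 1, j - 1)) ` ?D'"
    have D: "?D = ?R \<union> ?S"
      by (rule diagram_beyond_step[OF y k k0 pres dom e z(3)])
    have disj: "?R \<inter> ?S = {}" by (auto simp: diagram_beyond_def)
    have inj: "inj_on (\<lambda>(i, j). (i - 1, j - 1)) ?D'"
      by (auto simp: inj_on_def diagram_beyond_def)
    have fin: "finite ?D" unfolding D using IH(1) by simp
    \<comment> \<open>Lowering both coordinates by one compensates the passage from \<open>m\<close>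
      to \<open>m + 1\<close> in the variables.\<close>
    have "(\<Prod>(i, j)\<in>?S. cell_weight (i - m) (j - m)) =
        (\<Prod>(i, j)\<in>?D'. cell_weight (i - 1 - m) (j - 1 - m))"
      by (subst prod.reindex[OF inj]) (simp add: case_prod_unfold)
    also have "\<dots> = stage (m + 1) z" unfolding IH(2) by simp
    finally have S: "(\<Prod>(i, j)\<in>?S. cell_weight (i - m) (j - m)) = stage (m + 1) z" .
    have "(\<Prod>(i, j)\<in>?R. cell_weight (i - m) (j - m)) =
        (\<Prod>i = ?k + e..<?k + k. cell_weight (i - m) (m + 1))"
      by (subst prod.reindex) (auto simp: inj_on_def)
    also have "\<dots> = (if e = 0 then X (m + 1) else 1) *
        (\<Prod>i = 2 * m + 2..<?k + k. cell_weight (i - m) (m + 1))"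
    proof (cases "e = 0")
      case True
      have "{?k + e..<?k + k} = insert ?k {2 * m + 2..<?k + k}" using True k0 by auto
      then show ?thesis using True by (simp add: cell_weight_def)
    next
      case False
      then show ?thesis using start_cases by simp
    qed
    also have "(\<Prod>i = 2 * m + 2..<?k + k. cell_weight (i - m) (m + 1)) =
        (\<Prod>i = 2 * m + 2..<?k + k. X (m + 1) + X (i - m))"
      by (rule prod.cong) (auto simp: cell_weight_def add.commute)
    finally have R: "(\<Prod>(i, j)\<in>?R. cell_weight (i - m) (j - m)) = (if e = 0 then X (m + 1) else 1) *
        (\<Prod>i = 2 * m + 2..<?k + k. X (m + 1) + X (i - m))" .
    have "(\<Prod>(i, j)\<in>?D. cell_weight (i - m) (j - m)) = stage m y"
      unfolding D z(4) R[symmetric] S[symmetric] using disj IH(1) by (intro prod.union_disjoint) auto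
    with fin show ?thesis by simp
  qed
qed

end

section \<open>The Schubert polynomials\<close>

text \<open>Because consecutive letters of an ascending word \<open>a\<close> differ, the compatible sequences \<open>I\<close> of \<open>a\<close> are
  those for which the list of pairs \<open>zip a I\<close> is strictly sorted in the following order.\<close>

definition factor_before :: "nat \<times> nat \<Rightarrow> nat \<times> nat \<Rightarrow> bool" where
  "factor_before f g \<longleftrightarrow> snd f < snd g \<or> snd f = snd g \<and> fst g < fst f"

text \<open>For strictly sorted \<open>L\<close>, the strictly sorted lists over
  \<open>set L\<close> are exactly the subwords of \<open>L\<close>, each occurring once.\<close>

definition subwords :: "(nat \<Rightarrow> nat) \<Rightarrow> (nat \<times> nat) list \<Rightarrow> (nat \<Rightarrow> nat) \<Rightarrow> (nat \<times> nat) list set" where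
  "subwords v L z = {w. sorted_wrt factor_before w \<and> set w \<subseteq> set L \<and>
     ascent_word v (map fst w) \<and> inv_act v (map fst w) = z}"

lemma subwords_snoc:
  assumes v: "involution v" and L: "sorted_wrt factor_before (L @ [(i, p)])"
  shows "subwords v (L @ [(i, p)]) z = subwords v L z \<union>
    (if involution z \<and> z (Suc i) < z i then (\<lambda>w. w @ [(i, p)]) ` subwords v L (inv_step z i) else {})"
    (is "?l = ?r")
proof -
  have last: "(i, p) \<notin> set L" "\<And>f. f \<in> set L \<Longrightarrow> factor_before f (i, p)"
    using L by (auto simp: sorted_wrt_append factor_before_def)
  have snoc: "w @ [(i, p)] \<in> ?l \<longleftrightarrow>
      involution z \<and> z (Suc i) < z i \<and> w \<in> subwords v L (inv_step z i)" for w
  proof -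
    have "sorted_wrt factor_before (w @ [(i, p)]) \<and> set (w @ [(i, p)]) \<subseteq> set (L @ [(i, p)]) \<longleftrightarrow>
        sorted_wrt factor_before w \<and> set w \<subseteq> set L" (is "?a \<longleftrightarrow> ?b")
    proof
      assume a: ?a
      then have "(i, p) \<notin> set w" by (auto simp: sorted_wrt_append factor_before_def)
      with a show ?b by (auto simp: sorted_wrt_append subset_insert)
    qed (use last in \<open>auto simp: sorted_wrt_append\<close>)
    then show ?thesis
      using ascent_word_snoc[OF v, of "map fst w" i z] by (auto simp: subwords_def)
  qed
  show ?thesis
  proof (intro equalityI subsetI)
    fix w assume w: "w \<in> ?l"
    show "w \<in> ?r"
    proof (cases "(i, p) \<in> set w")
      case False
      with w show ?thesis by (auto simp: subwords_def)
    next
      case True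
      then obtain u g where u: "w = u @ [g]" by (cases w rule: rev_cases) auto
      \<comment> \<open>All other factors in \<open>L\<close> precede \<open>(i, p)\<close>, so
        nothing can follow it in a sorted list.\<close>
      have "g = (i, p)"
      proof (rule ccontr)
        assume g: "g \<noteq> (i, p)"
        with True u have "(i, p) \<in> set u" by simp
        then have "factor_before (i, p) g" using w u by (simp add: subwords_def sorted_wrt_append)
        moreover have "g \<in> set L" using w u g by (auto simp: subwords_def)
        ultimately show False using last(2)[of g] by (auto simp: factor_before_def)
      qed
      with w u snoc[of u] show ?thesis by auto
    qed
  next
    fix w assume "w \<in> ?r"
    then consider "w \<in> subwords v L z"
      | u where "w = u @ [(i, p)]" "involution z" "z (Suc i) < z i" "u \<in> subwords v L (inv_step z i)"
      by (auto split: if_splits)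
    then show "w \<in> ?l"
    proof cases
      case 1
      then show ?thesis by (auto simp: subwords_def)
    next
      case 2
      then show ?thesis using snoc[of u] by simp
    qed
  qed
qed

text \<open>Expansion of the product: each factor contributes 1 or \<open>x u_i\<close>, and the
  chosen letters must form an ascending walk from \<open>v\<close> to \<open>z\<close>.\<close>

lemma raise_delta_eq_sum_subwords:
  fixes x :: "nat \<Rightarrow> 'a::comm_ring_1"
  assumes v: "involution v" and "sorted_wrt factor_before L"
  shows "finite (subwords v L z) \<and> raise (map (\<lambda>(i, p). (i, x p)) L) (delta v) z =
    (\<Sum>w\<in>subwords v L z. \<Prod>p\<leftarrow>map snd w. x p)"
  using assms(2)
proof (induction L arbitrary: z rule: rev_induct)
  case Nil
  have "subwords v [] z = (if z = v then {[]} else {})" by (auto simp: subwords_def)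
  then show ?case by (simp add: delta_def)
next
  case (snoc f L)
  obtain i p where f: "f = (i, p)" by (cases f)
  have L: "sorted_wrt factor_before L" using snoc.prems by (simp add: sorted_wrt_append)
  note IH = snoc.IH[OF L]
  let ?S = "if involution z \<and> z (Suc i) < z i then (\<lambda>w. w @ [(i, p)]) ` subwords v L (inv_step z i) else {}"
  have sub: "subwords v (L @ [f]) z = subwords v L z \<union> ?S"
    using subwords_snoc[OF v] snoc.prems f by simp
  have "(i, p) \<notin> set L" using snoc.prems f by (auto simp: sorted_wrt_append factor_before_def)
  then have disj: "subwords v L z \<inter> ?S = {}" by (auto simp: subwords_def)
  have fin: "finite ?S" using IH by simp
  have "(\<Sum>w\<in>?S. \<Prod>p\<leftarrow>map snd w. x p) =
      x p * lowering i (raise (map (\<lambda>(i, p). (i, x p)) L) (delta v)) z"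
    using IH by (auto simp: lowering_def sum.reindex inj_on_def sum_distrib_left mult.commute)
  then show ?case
    using IH[of z] fin disj by (simp add: sub sum.union_disjoint) (simp add: f raising_def)
qed

text \<open>Letters paired with variable indices, in the order of \<open>staircase N 1\<close>. The
  inner range starts at \<open>p\<close>, which encodes the condition
  \<open>I \<le> a\<close>.\<close>

definition factors :: "nat \<Rightarrow> (nat \<times> nat) list" where
  "factors N = concat (map (\<lambda>p. map (\<lambda>i. (i, p)) (rev [p..<N])) [1..<N])"

lemma set_factors: "set (factors N) = {(i, p). 1 \<le> p \<and> p \<le> i \<and> i < N}"
  by (auto simp: factors_def image_iff)

lemma sorted_factors: "sorted_wrt factor_before (factors N)"
proof -
  have row: "sorted_wrt factor_before (map (\<lambda>i. (i, p)) (rev [p..<N]))" for p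
    by (simp add: sorted_wrt_map sorted_wrt_rev factor_before_def)
  have "sorted_wrt factor_before (concat (map (\<lambda>p. map (\<lambda>i. (i, p)) (rev [p..<N])) ps))"
    if "sorted_wrt (<) ps" for ps
    using that
  proof (induction ps)
    case (Cons p ps)
    then show ?case using row[of p] by (simp add: sorted_wrt_append) (auto simp: factor_before_def)
  qed simp
  then show ?thesis unfolding factors_def by simp
qed

lemma staircase_eq_factors: "staircase N 1 x = map (\<lambda>(i, p). (i, x p)) (factors N)"
  by (simp add: staircase_def factors_def descending_def map_concat comp_def)

lemma transp_factor_before: "transp factor_before"
  by (rule transpI) (auto simp: factor_before_def)

text \<open>A word \<open>a\<close> with a compatible sequence \<open>I\<close> corresponds to
  \<open>zip a I\<close>, so the double sum runs over the subwords of \<open>factors N\<close>,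
  grouped by their letters.\<close>

lemma rel_inv_schubert_eq_raise:
  assumes v: "finitary_involution v" and z: "finitary_involution z" "\<And>p. N < p \<Longrightarrow> z p = p"
  shows "rel_inv_schubert v z = raise (staircase N 1 var) (delta v) z"
proof -
  let ?R = "rel_inv_words v z" and ?W = "subwords v (factors N) z"
  have iv: "involution v" using v by (simp add: finitary_involution_def)
  have R: "a \<in> pos_words" "ascent_word v a" "inv_act v a = z" "\<forall>i\<in>set a. i < N" if "a \<in> ?R" for a
    using that ascent_word_letters[OF iv _ _ z(2), of a] by (simp_all add: rel_inv_words_eq[OF v z(1)])
  have "?R \<subseteq> {a. set a \<subseteq> {..<N} \<and> length a \<le> rank z}"
  proof
    fix a assume "a \<in> ?R"
    from R[OF this] rank_inv_act[OF v, of a] show "a \<in> {a. set a \<subseteq> {..<N} \<and> length a \<le> rank z}" by auto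
  qed
  then have finR: "finite ?R" by (rule finite_subset) (simp add: finite_lists_length_le)
  note W = raise_delta_eq_sum_subwords[OF iv sorted_factors[of N], of z var]
  have image: "map fst ` ?W \<subseteq> ?R"
  proof
    fix a assume "a \<in> map fst ` ?W"
    then obtain w where w: "w \<in> ?W" "a = map fst w" by blast
    then have "a \<in> pos_words" by (fastforce simp: subwords_def set_factors pos_words_def)
    with w show "a \<in> ?R" by (simp add: rel_inv_words_eq[OF v z(1)] subwords_def)
  qed
  have inner: "(\<Sum>I\<in>{I \<in> compatible_seqs a. seq_le I a}. monomial I) =
      (\<Sum>w\<in>{w \<in> ?W. map fst w = a}. monomial (map snd w))" if a: "a \<in> ?R" for a
  proof (rule sum.reindex_bij_witness[of _ "map snd" "zip a"])
    fix I assume "I \<in> {I \<in> compatible_seqs a. seq_le I a}"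
    then have I: "length I = length a" "I \<in> pos_words" "\<And>j. j < length a \<Longrightarrow> I ! j \<le> a ! j"
      "\<And>j. Suc j < length a \<Longrightarrow> I ! j \<le> I ! Suc j \<and> (a ! j < a ! Suc j \<longrightarrow> I ! j < I ! Suc j)"
      by (auto simp: compatible_seqs_def seq_le_def list_all2_conv_all_nth)
    show "map snd (zip a I) = I" using I by simp
    have "sorted_wrt factor_before (zip a I)"
      unfolding sorted_wrt_iff_nth_Suc_transp[OF transp_factor_before]
    proof (intro allI impI)
      fix j assume "Suc j < length (zip a I)"
      then have j: "Suc j < length a" by simp
      \<comment> \<open>Neighbouring letters differ, so equal neighbouring indices force the letters
        to decrease.\<close>
      show "factor_before (zip a I ! j) (zip a I ! Suc j)"
        using I(4)[OF j] ascent_word_no_repeat[OF R(2)[OF a] iv j] j I(1)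
        by (auto simp: factor_before_def)
    qed
    moreover have "set (zip a I) \<subseteq> set (factors N)"
    proof (rule subrelI)
      fix i p assume "(i, p) \<in> set (zip a I)"
      then obtain j where "j < length a" "i = a ! j" "p = I ! j"
        using I(1) by (auto simp: set_zip)
      then show "(i, p) \<in> set (factors N)"
        using I(1-3) R(4)[OF a] by (auto simp: set_factors pos_words_def)
    qed
    ultimately show "zip a I \<in> {w \<in> ?W. map fst w = a}"
      using R[OF a] I(1) by (simp add: subwords_def)
    show "monomial (map snd (zip a I)) = monomial I" using I by simp
  next
    fix w assume "w \<in> {w \<in> ?W. map fst w = a}"
    then have w: "w \<in> ?W" and aw: "a = map fst w" by auto
    show "zip a (map snd w) = w" unfolding aw by (rule zip_map_fst_snd)
    have s: "sorted_wrt factor_before w" "set w \<subseteq> set (factors N)" using w by (simp_all add: subwords_def)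
    have nth: "1 \<le> snd (w ! j) \<and> snd (w ! j) \<le> fst (w ! j)" if "j < length w" for j
      using s(2) nth_mem[OF that] by (cases "w ! j") (auto simp: set_factors)
    have "map snd w \<in> compatible_seqs a"
      unfolding compatible_seqs_def
    proof (intro CollectI conjI allI impI)
      show "map snd w \<in> pos_words" using s(2) by (force simp: pos_words_def set_factors)
      show "length (map snd w) = length a" by (simp add: aw)
      fix j assume "j + 1 < length a"
      then have "j < length w" "Suc j < length w" "factor_before (w ! j) (w ! Suc j)"
        using s(1) by (auto simp: aw sorted_wrt_iff_nth_less)
      then show "map snd w ! j \<le> map snd w ! (j + 1)"
        "a ! j < a ! (j + 1) \<Longrightarrow> map snd w ! j < map snd w ! (j + 1)"
        by (auto simp: aw factor_before_def)
    qed
    moreover have "seq_le (map snd w) a"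
      using nth by (simp add: seq_le_def list_all2_conv_all_nth aw)
    ultimately show "map snd w \<in> {I \<in> compatible_seqs a. seq_le I a}" by simp
  qed
  have "rel_inv_schubert v z = (\<Sum>a\<in>?R. \<Sum>w\<in>{w \<in> ?W. map fst w = a}. monomial (map snd w))"
    unfolding rel_inv_schubert_def by (rule sum.cong[OF refl inner])
  also have "\<dots> = (\<Sum>w\<in>?W. monomial (map snd w))"
    using W by (intro sum.group finR image) auto
  also have "\<dots> = raise (staircase N 1 var) (delta v) z"
    unfolding staircase_eq_factors using W by (simp add: monomial_def)
  finally show ?thesis .
qed

section \<open>The two product formulas\<close>

lemma finitary_involution_if:
  assumes "y \<in> involutions n"
  shows "finitary_involution y" "\<And>p. n < p \<Longrightarrow> y p = p"
proof -
  have y: "y permutes {1..n}" "y = inv y" using assms by (simp_all add: involutions_def)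
  show fixed: "y p = p" if "n < p" for p using permutes_not_in[OF y(1)] that by simp
  have "y (y p) = p" for p using permutes_inverses(1)[OF y(1), of p] y(2) by simp
  moreover have "y 0 = 0" using permutes_not_in[OF y(1)] by simp
  ultimately show "finitary_involution y" using fixed by (auto simp: finitary_involution_def involution_def)
qed

lemma (in involution_start) dominant_beyond_0: "dominant y \<Longrightarrow> dominant_beyond 0 y"
  unfolding dominant_def dominant_beyond_def by (metis One_nat_def Suc_leI)

lemma const_mult: "const a * const b = const (a * b)"
  by (simp add: const_def mult_single)

lemma const_1: "const 1 = 1"
  by (simp add: const_def)

lemma const_2: "const 2 = 2"
  unfolding const_def by (metis one_add_one single_add single_one)

lemma const_power: "const a ^ k = const (a ^ k)"
  by (induction k) (simp_all add: const_mult const_1)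

lemma involution_start_id: "involution_start TYPE('a::comm_ring_1) n 0 id"
  by unfold_locales (auto simp: involution_id raise_descending_delta_id)

lemma involution_start_min_fpf: "involution_start TYPE('a::comm_ring_1) (2 * n) 1 (min_fpf n)"
proof
  show "involution (min_fpf n)" by (rule involution_min_fpf)
  show "min_fpf n p = p" if "2 * n < p" for p using that by (rule min_fpf_beyond)
  show "min_fpf n p \<le> c" if "even c" "c \<le> 2 * n" "p \<le> c" for c p
  proof (cases "odd p")
    case True
    then have "p \<noteq> c" using that(1) by auto
    with that show ?thesis by (auto simp: min_fpf_def)
  qed (use that in \<open>auto simp: min_fpf_def\<close>)
qed (auto simp: raise_descending_delta_min_fpf min_fpf_odd)

text \<open>Each diagonal cell accounts for one factor 2, the quotient of \<open>X i + X i\<close>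
  and its weight in \<open>stage_dominant\<close>.\<close>

lemma prod_diagonal_cells:
  fixes X :: "nat \<Rightarrow> 'a::comm_ring_1"
  assumes "finite D"
  shows "(\<Prod>(i, j)\<in>D. X i + X j) =
    2 ^ card {i. (i, i) \<in> D} * (\<Prod>(i, j)\<in>D. if i = j then X i else X i + X j)"
proof -
  have "(\<Prod>(i, j)\<in>D. X i + X j) =
      (\<Prod>(i, j)\<in>D. (if i = j then 2 else 1) * (if i = j then X i else X i + X j))"
    by (rule prod.cong) auto
  also have "\<dots> = (\<Prod>(i, j)\<in>D. if i = j then 2 else 1) * (\<Prod>(i, j)\<in>D. if i = j then X i else X i + X j)"
    by (simp add: case_prod_unfold prod.distrib)
  also have "(\<Prod>(i, j)\<in>D. if i = j then 2 else (1 :: 'a)) = (\<Prod>f\<in>{f \<in> D. fst f = snd f}. 2)"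
    unfolding case_prod_unfold by (rule prod.inter_filter[OF assms, symmetric])
  also have "\<dots> = 2 ^ card {f \<in> D. fst f = snd f}" by simp
  also have "{f \<in> D. fst f = snd f} = (\<lambda>i. (i, i)) ` {i. (i, i) \<in> D}" by force
  also have "card \<dots> = card {i. (i, i) \<in> D}" by (rule card_image) (simp add: inj_on_def)
  finally show ?thesis .
qed

text \<open>A diagonal cell \<open>(i, i)\<close> records \<open>i < y i\<close>, so it marks the
  smaller element of a 2-cycle.\<close>

lemma num_two_cycles_eq_diagonal:
  assumes "finitary_involution y"
  shows "num_two_cycles y = card {i. (i, i) \<in> inv_diagram y}"
proof -
  have y: "involution y" "y 0 = 0" using assms by (simp_all add: finitary_involution_def)
  have "{(i, j). i < j \<and> y i = j \<and> y j = i} = (\<lambda>i. (i, y i)) ` {i. i < y i}"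
    using involutionD[OF y(1)] by auto
  moreover have "{i. (i, i) \<in> inv_diagram y} = {i. i < y i}"
  proof -
    have "1 \<le> i" if "i < y i" for i using that y(2) by (cases i) auto
    then show ?thesis by (auto simp: inv_diagram_def)
  qed
  ultimately show ?thesis
    unfolding num_two_cycles_def by (simp add: card_image inj_on_def)
qed

theorem theorem1p3:
  fixes n :: nat and y z :: "nat \<Rightarrow> nat"
  assumes "y \<in> involutions n"
    and "z \<in> fpf_involutions (2 * n)"
    and "dominant y"
    and "dominant z"
  shows "inv_schubert y =
      const (1 / 2 ^ num_two_cycles y) * (\<Prod>(i, j)\<in>inv_diagram y. var i + var j)
    \<and> fpf_schubert n z = (\<Prod>(i, j)\<in>fpf_diagram z. var i + var j)"
proof
  interpret id: involution_start n 0 id var by (rule involution_start_id)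
  note y = finitary_involution_if[OF assms(1)]
  have y': "involution y" "y 0 = 0" using y(1) by (simp_all add: finitary_involution_def)
  have "id.diagram_beyond 0 y = inv_diagram y"
    unfolding id.diagram_beyond_def inv_diagram_def by auto
  then have 1: "finite (inv_diagram y)"
    "id.stage 0 y = (\<Prod>(i, j)\<in>inv_diagram y. if i = j then var i else var i + var j)"
    using id.stage_dominant[of 0 y] y y' id.dominant_beyond_0[OF assms(3)]
    by (auto simp: id.cell_weight_def)
  have "inv_schubert y = id.stage 0 y"
    unfolding inv_schubert_def id.stage_def
    using rel_inv_schubert_eq_raise[OF finitary_involution_id y] by simp
  moreover have "const (1 / 2 ^ num_two_cycles y) * 2 ^ num_two_cycles y = 1"
    by (simp add: const_mult const_power const_1 flip: const_2)
  ultimately show "inv_schubert y =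
      const (1 / 2 ^ num_two_cycles y) * (\<Prod>(i, j)\<in>inv_diagram y. var i + var j)"
    unfolding prod_diagonal_cells[OF 1(1)] num_two_cycles_eq_diagonal[OF y(1), symmetric]
    by (simp add: 1(2) flip: mult.assoc)
next
  interpret fpf: involution_start "2 * n" 1 "min_fpf n" var by (rule involution_start_min_fpf)
  have "z \<in> involutions (2 * n)" and fpf: "\<And>p. 0 < p \<Longrightarrow> p \<le> 2 * n \<Longrightarrow> z p \<noteq> p"
    using assms(2) by (auto simp: fpf_involutions_def)
  note z = finitary_involution_if[OF this(1)]
  have z': "involution z" "z 0 = 0" using z(1) by (simp_all add: finitary_involution_def)
  have v: "finitary_involution (min_fpf n)"
    using involution_min_fpf min_fpf_0 min_fpf_beyond unfolding finitary_involution_def by blast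
  have D: "fpf.diagram_beyond 0 z = fpf_diagram z"
    unfolding fpf.diagram_beyond_def fpf_diagram_def by auto
  have "fpf_schubert n z = fpf.stage 0 z"
    unfolding fpf_schubert_def fpf.stage_def
    using rel_inv_schubert_eq_raise[OF v z] by simp
  also have "\<dots> = (\<Prod>(i, j)\<in>fpf_diagram z. if i = j then var i else var i + var j)"
    using fpf.stage_dominant[of 0 z] z z' fpf fpf.dominant_beyond_0[OF assms(4)] D min_fpf_0[of n]
    by (auto simp: fpf.cell_weight_def)
  \<comment> \<open>There are no diagonal cells here, so no power of 2 appears.\<close>
  also have "\<dots> = (\<Prod>(i, j)\<in>fpf_diagram z. var i + var j)"
    by (rule prod.cong) (auto simp: fpf_diagram_def)
  finally show "fpf_schubert n z = (\<Prod>(i, j)\<in>fpf_diagram z. var i + var j)" .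
qed

end
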